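(* The divergence-regularized loss $$\mathbb E_{(x,z^\delta)\sim p(x,z^\delta)}\left(\tfrac12\|\varphi(x)-z^\delta\|^2-\hat\delta^2\,\nabla\cdot\varphi(x)\right),$$ whose minimizer over $\varphi$ is denoted $\varphi_{\mathrm{div}}$, is equivalent (i.e. equal up to an additive constant that does not depend on $\varphi$) to $$\mathbb E_{x\sim p_X}\left(\tfrac12\left\|\varphi(x)-\bigl(A^\ast A x-\hat\delta^2\,\nabla_x(\log p_X)(x)\bigr)\right\|^2\right).$$ Therefore, the optimal solution for unconstrained $\varphi$ is $$\varphi_{\mathrm{div}}=A^\ast A-\hat\delta^2\,\nabla_x(\log p_X).$$
   Context: $X=\mathbb R^{n_X}$ and $Y=\mathbb R^{n_Y}$ with Euclidean inner products; $A:X\to Y$ is linear with adjoint $A^\ast$; $\delta>0$ is the noise level of the data and $\hat\delta>0$ is a chosen regularization parameter. The prior $p_X:X\to\mathbb R_{>0}$ is a continuously differentiable, everywhere positive probability density. The joint law $p(x,z^\delta)$ is that of $x\sim p_X$ and $z^\delta=A^\ast(Ax+\eta)$, where $\eta\sim\mathcal N(0,\delta^2 I)$ on $Y$ is independent of $x$. The models $\varphi$ are taken in $\mathrm{Diff}^2(X)$, the set of bijective $C^2$ maps $X\to X$ with $C^2$ inverse; $\nabla\cdot\varphi=\operatorname{tr}\mathrm D\varphi$ is the divergence. The minimizer is $\varphi_{\mathrm{div}}=\arg\min_\varphi$ of the divergence-regularized loss; "unconstrained" means that no further restriction, such as to a particular invertible network architecture, is imposed on $\varphi$. Standing assumption: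 $p_X$ decays sufficiently fast that all expectations involved exist, i.e. $\mathbb E_{p_X}\|x\|^2$, $\mathbb E_{p_X}\|\nabla\log p_X(x)\|^2$ and, for the $\varphi$ considered, $\mathbb E_{p_X}\|\varphi(x)\|^2$ and $\mathbb E_{p_X}|\nabla\cdot\varphi(x)|$ are finite. *)

theory Defs
  imports "HOL-Probability.Probability"
begin

definition C1_map :: "('a::real_normed_vector \<Rightarrow> 'b::real_normed_vector) \<Rightarrow> bool" where
  "C1_map f \<longleftrightarrow> (\<exists>f' :: 'a \<Rightarrow> 'a \<Rightarrow>\<^sub>L 'b.
     (\<forall>x. (f has_derivative blinfun_apply (f' x)) (at x)) \<and> continuous_on UNIV f')"

definition C2_map :: "('a::real_normed_vector \<Rightarrow> 'b::real_normed_vector) \<Rightarrow> bool" where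
  "C2_map f \<longleftrightarrow> (\<exists>f' :: 'a \<Rightarrow> 'a \<Rightarrow>\<^sub>L 'b.
     (\<forall>x. (f has_derivative blinfun_apply (f' x)) (at x)) \<and> C1_map f')"

definition Diff2 :: "('a::real_normed_vector \<Rightarrow> 'a) set" where
  "Diff2 = {\<phi>. bij \<phi> \<and> C2_map \<phi> \<and> C2_map (inv \<phi>)}"

text \<open>Both operators below are only meaningful at points of differentiability; they are applied
  to a \<open>C\<^sup>1\<close> density (through its logarithm) and to members of \<^const>\<open>Diff2\<close>.\<close>

definition gradient :: "('a::real_inner \<Rightarrow> real) \<Rightarrow> 'a \<Rightarrow> 'a" where
  "gradient f x = (THE g. GDERIV f x :> g)"

definition divergence :: "(real^'n \<Rightarrow> real^'n) \<Rightarrow> real^'n \<Rightarrow> real" where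
  "divergence \<phi> x = trace (jacobian \<phi> (at x))"

definition prior :: "('a::euclidean_space \<Rightarrow> real) \<Rightarrow> 'a measure" where
  "prior p = density lborel (\<lambda>x. ennreal (p x))"

text \<open>\<open>N(0, \<delta>\<^sup>2 I)\<close>; the second argument of \<^const>\<open>normal_density\<close> is the standard deviation.\<close>

definition gaussian_noise :: "real \<Rightarrow> (real^'m) measure" where
  "gaussian_noise \<delta> = density lborel (\<lambda>\<eta>. ennreal (\<Prod>i\<in>UNIV. normal_density 0 \<delta> (\<eta> $ i)))"

text \<open>The law of \<open>(x, A\<^sup>* (A x + \<eta>))\<close>; independence of \<open>x\<close> and \<open>\<eta>\<close> is the product measure.\<close>

definition joint_law ::
    "(real^'n \<Rightarrow> real^'m) \<Rightarrow> real \<Rightarrow> (real^'n \<Rightarrow> real) \<Rightarrow> ((real^'n) \<times> (real^'n)) measure" where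
  "joint_law A \<delta> p =
     distr (prior p \<Otimes>\<^sub>M gaussian_noise \<delta>) (borel \<Otimes>\<^sub>M borel) (\<lambda>(x, \<eta>). (x, adjoint A (A x + \<eta>)))"

definition div_reg_loss ::
    "(real^'n \<Rightarrow> real^'m) \<Rightarrow> real \<Rightarrow> real \<Rightarrow> (real^'n \<Rightarrow> real) \<Rightarrow> (real^'n \<Rightarrow> real^'n) \<Rightarrow> real" where
  "div_reg_loss A \<delta> \<delta>' p \<phi> =
     (\<integral>(x, z). 1/2 * (norm (\<phi> x - z))\<^sup>2 - \<delta>'\<^sup>2 * divergence \<phi> x \<partial>joint_law A \<delta> p)"

definition models :: "(real^'n \<Rightarrow> real) \<Rightarrow> (real^'n \<Rightarrow> real^'n) set" where
  "models p = {\<phi> \<in> Diff2. integrable (prior p) (\<lambda>x. (norm (\<phi> x))\<^sup>2) \<and>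
                           integrable (prior p) (\<lambda>x. \<bar>divergence \<phi> x\<bar>)}"

end

theory Submission
  imports Defs
begin

text \<open>The noise \<open>A\<^sup>*\<eta>\<close> is centred and independent of \<open>x\<close>, so it only adds a constant to the quadratic
  part of the loss. Integration by parts against \<open>p\<close> (Stein's identity
  \<open>E (\<nabla>\<cdot>\<phi>) = - E (\<phi> \<bullet> \<nabla> ln p)\<close>) turns the divergence into an inner product, and completing the
  square gives the first claim; the boundary terms are removed with cut-offs, using that \<open>\<phi>\<close> and
  \<open>\<nabla> ln p\<close> are square integrable.

  The unconstrained optimum \<open>g\<close> need not itself be a diffeomorphism, so uniqueness of the minimizer
  requires an argument inside \<open>Diff\<^sup>2\<close>: if \<open>\<phi> x\<^sub>0 \<noteq> g x\<^sub>0\<close>, then pushing the values of \<open>\<phi>\<close> near \<open>\<phi> x\<^sub>0\<close> in the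
  direction \<open>g x\<^sub>0 - \<phi> x\<^sub>0\<close> by a small bump stays inside \<open>Diff\<^sup>2\<close> and strictly decreases the loss.\<close>

section \<open>Perturbations in \<open>Diff\<^sup>2\<close>\<close>

text \<open>Adding a bump in \<open>x\<close> to \<open>\<phi>\<close> would tie invertibility to
  lower bounds on the derivative of \<open>\<phi>\<close>. The perturbation is therefore applied
  after \<open>\<phi>\<close>, as \<open>\<phi> x + bump y r (\<phi> x) *\<^sub>R e\<close>: closure
  of \<open>Diff2\<close> under composition leaves only a perturbation of the identity to invert,
  and its smallness condition involves \<open>r\<close> and \<open>e\<close> alone. The price lies
  in the integrability clauses of \<open>models p\<close>: the divergence changes by a term
  containing the derivative of \<open>\<phi>\<close>, for which no growth bound is known. It is
  harmless because its support lies in the preimage of a ball under a homeomorphism, which is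
  compact.

  One bump, with derivative bounded by \<open>6 / r\<close>, serves twice: a small displacement
  \<open>e\<close> makes the perturbation invertible, and a large radius makes it a cut-off whose
  error term is of order \<open>1 / r\<close>.

  Attainment is not claimed: if the optimum lies outside \<open>models p\<close>, both sides of the
  final equivalence are false for every \<open>\<phi>\<close>. Continuity together with positivity
  of the prior makes uniqueness hold at every point, not merely almost everywhere.\<close>

lemma C1_mapI:
  assumes "\<And>x. (f has_derivative blinfun_apply (f' x)) (at x)" "continuous_on UNIV f'"
  shows "C1_map f"
  using assms unfolding C1_map_def by blast

lemma C2_mapI:
  assumes "\<And>x. (f has_derivative blinfun_apply (f' x)) (at x)" "C1_map f'"
  shows "C2_map f"
  using assms unfolding C2_map_def by blast

lemma C1_map_continuous:
  assumes "C1_map f"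
  shows "continuous_on UNIV f"
proof -
  obtain f' where f: "\<And>x. (f has_derivative blinfun_apply (f' x)) (at x)"
    using assms unfolding C1_map_def by blast
  show ?thesis
    by (rule has_derivative_continuous_on[OF has_derivative_at_withinI[OF f]])
qed

lemma C1_map_compose:
  assumes "C1_map f" "C1_map g"
  shows "C1_map (\<lambda>x. f (g x))"
proof -
  obtain f' where f: "\<And>x. (f has_derivative blinfun_apply (f' x)) (at x)" "continuous_on UNIV f'"
    using assms(1) unfolding C1_map_def by blast
  obtain g' where g: "\<And>x. (g has_derivative blinfun_apply (g' x)) (at x)" "continuous_on UNIV g'"
    using assms(2) unfolding C1_map_def by blast
  note gc = C1_map_continuous[OF assms(2)]
  have "((\<lambda>x. f (g x)) has_derivative blinfun_apply (f' (g x) o\<^sub>L g' x)) (at x)" for x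
    by (rule has_derivative_eq_rhs[OF has_derivative_compose[OF g(1) f(1)]]) (simp add: fun_eq_iff)
  moreover have "continuous_on UNIV (\<lambda>x. f' (g x) o\<^sub>L g' x)"
    by (intro bounded_bilinear.continuous_on[OF bounded_bilinear_blinfun_compose] g(2)
        continuous_on_compose2[OF f(2) gc]) auto
  ultimately show ?thesis
    by (rule C1_mapI)
qed

lemma C1_map_bounded_linear: "bounded_linear f \<Longrightarrow> C1_map f"
  unfolding C1_map_def
  by (intro exI[of _ "\<lambda>_. Blinfun f"])
    (simp add: bounded_linear_Blinfun_apply bounded_linear_imp_has_derivative)

lemma C1_map_const: "C1_map (\<lambda>_. c)"
  by (rule C1_mapI[of _ "\<lambda>_. 0"], rule has_derivative_eq_rhs[OF has_derivative_const])
    (simp_all add: fun_eq_iff)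

lemma C1_map_add:
  assumes "C1_map f" "C1_map g"
  shows "C1_map (\<lambda>x. f x + g x)"
proof -
  obtain f' where f: "\<And>x. (f has_derivative blinfun_apply (f' x)) (at x)" "continuous_on UNIV f'"
    using assms(1) unfolding C1_map_def by blast
  obtain g' where g: "\<And>x. (g has_derivative blinfun_apply (g' x)) (at x)" "continuous_on UNIV g'"
    using assms(2) unfolding C1_map_def by blast
  have "((\<lambda>x. f x + g x) has_derivative blinfun_apply (f' x + g' x)) (at x)" for x
    using has_derivative_add[OF f(1) g(1)] by (simp add: plus_blinfun.rep_eq)
  then show ?thesis
    by (rule C1_mapI) (intro continuous_on_add f g)
qed

text \<open>The product rule for an arbitrary bounded bilinear operation covers both scalar
  multiplication and the composition of bounded linear maps. The latter is what differentiating the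
  chain rule a second time requires.\<close>

lemma C1_map_bilinear:
  assumes "bounded_bilinear B" "C1_map f" "C1_map g"
  shows "C1_map (\<lambda>x. B (f x) (g x))"
proof -
  interpret bounded_bilinear B by fact
  obtain f' where f: "\<And>x. (f has_derivative blinfun_apply (f' x)) (at x)" "continuous_on UNIV f'"
    using assms(2) unfolding C1_map_def by blast
  obtain g' where g: "\<And>x. (g has_derivative blinfun_apply (g' x)) (at x)" "continuous_on UNIV g'"
    using assms(3) unfolding C1_map_def by blast
  note c = C1_map_continuous[OF assms(2)] C1_map_continuous[OF assms(3)]
  let ?D = "\<lambda>x. (prod_right (f x) o\<^sub>L g' x) + (prod_left (g x) o\<^sub>L f' x)"
  have "((\<lambda>x. B (f x) (g x)) has_derivative blinfun_apply (?D x)) (at x)" for x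
    by (rule has_derivative_eq_rhs[OF FDERIV[OF f(1) g(1)]])
      (simp add: plus_blinfun.rep_eq fun_eq_iff)
  moreover have "continuous_on UNIV ?D"
    by (intro continuous_on_add bounded_bilinear.continuous_on[OF bounded_bilinear_blinfun_compose]
        f(2) g(2) bounded_linear.continuous_on[OF bounded_linear_prod_right]
        bounded_linear.continuous_on[OF bounded_linear_prod_left] c)
  ultimately show ?thesis
    by (rule C1_mapI)
qed

lemma C1_map_linear_compose: "bounded_linear L \<Longrightarrow> C1_map g \<Longrightarrow> C1_map (\<lambda>x. L (g x))"
  by (rule C1_map_compose[OF C1_map_bounded_linear])

lemma C1_map_real_inverse:
  fixes f :: "'a::real_normed_vector \<Rightarrow> real"
  assumes "C1_map f" "\<And>x. f x \<noteq> 0"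
  shows "C1_map (\<lambda>x. inverse (f x))"
proof -
  obtain f' where f: "\<And>x. (f has_derivative blinfun_apply (f' x)) (at x)" "continuous_on UNIV f'"
    using assms(1) unfolding C1_map_def by blast
  let ?D = "\<lambda>x. - (inverse (f x) * inverse (f x)) *\<^sub>R f' x"
  have "((\<lambda>x. inverse (f x)) has_derivative blinfun_apply (?D x)) (at x)" for x
    by (rule has_derivative_eq_rhs[OF Deriv.has_derivative_inverse[OF assms(2) f(1)]])
      (simp add: scaleR_blinfun.rep_eq uminus_blinfun.rep_eq fun_eq_iff)
  moreover have "continuous_on UNIV ?D"
    using C1_map_continuous[OF assms(1)] f(2) assms(2) by (intro continuous_intros) auto
  ultimately show ?thesis
    by (rule C1_mapI)
qed

lemma C1_map_ln:
  fixes f :: "'a::real_normed_vector \<Rightarrow> real"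
  assumes "C1_map f" "\<And>x. f x > 0"
  shows "C1_map (\<lambda>x. ln (f x))"
proof -
  obtain f' where f: "\<And>x. (f has_derivative blinfun_apply (f' x)) (at x)" "continuous_on UNIV f'"
    using assms(1) unfolding C1_map_def by blast
  let ?D = "\<lambda>x. inverse (f x) *\<^sub>R f' x"
  have "((\<lambda>x. ln (f x)) has_derivative blinfun_apply (?D x)) (at x)" for x
    by (rule has_derivative_eq_rhs[OF has_derivative_ln[OF assms(2) f(1)]])
      (simp add: scaleR_blinfun.rep_eq fun_eq_iff)
  moreover have "continuous_on UNIV ?D"
    using C1_map_continuous[OF assms(1)] f(2) assms(2)
    by (intro continuous_intros) (auto simp: less_imp_neq[symmetric])
  ultimately show ?thesis
    by (rule C1_mapI)
qed

lemma C2_map_imp_C1_map: "C2_map f \<Longrightarrow> C1_map f"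
  unfolding C2_map_def C1_map_def[of f] using C1_map_continuous by metis

lemma C2_map_compose:
  assumes "C2_map f" "C2_map g"
  shows "C2_map (\<lambda>x. f (g x))"
proof -
  obtain f' where f: "\<And>x. (f has_derivative blinfun_apply (f' x)) (at x)" "C1_map f'"
    using assms(1) unfolding C2_map_def by blast
  obtain g' where g: "\<And>x. (g has_derivative blinfun_apply (g' x)) (at x)" "C1_map g'"
    using assms(2) unfolding C2_map_def by blast
  have "((\<lambda>x. f (g x)) has_derivative blinfun_apply (f' (g x) o\<^sub>L g' x)) (at x)" for x
    by (rule has_derivative_eq_rhs[OF has_derivative_compose[OF g(1) f(1)]]) (simp add: fun_eq_iff)
  moreover have "C1_map (\<lambda>x. f' (g x) o\<^sub>L g' x)"
    by (intro C1_map_bilinear[OF bounded_bilinear_blinfun_compose] C1_map_compose[OF f(2)] g(2)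
        C2_map_imp_C1_map assms(2))
  ultimately show ?thesis
    by (rule C2_mapI)
qed

text \<open>Inverses compose in the opposite order, so the \<open>C2_map\<close> clause for the
  inverse is again a composition. This lets a model be modified by a diffeomorphism of its target
  space.\<close>

lemma Diff2_compose:
  assumes "f \<in> Diff2" "g \<in> Diff2"
  shows "(\<lambda>x. f (g x)) \<in> Diff2"
proof -
  have b: "bij f" "bij g" using assms by (auto simp: Diff2_def)
  have "inv (\<lambda>x. f (g x)) = (\<lambda>x. inv g (inv f x))"
    using o_inv_distrib[OF b] by (simp add: o_def)
  moreover have "bij (\<lambda>x. f (g x))"
    using bij_comp[OF b(2) b(1)] by (simp add: o_def)
  ultimately show ?thesis
    using assms by (auto simp: Diff2_def intro: C2_map_compose)
qed

text \<open>The derivative \<open>id + e \<otimes> d\<psi>\<close> of the perturbation is a rank-one update of the identity, so its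
  inverse is given by the Sherman--Morrison formula and visibly inherits the regularity of \<open>d\<psi>\<close>.\<close>

lemma rank_one_perturbation_Diff2:
  fixes \<psi> :: "'a::euclidean_space \<Rightarrow> real" and \<psi>' :: "'a \<Rightarrow> 'a \<Rightarrow>\<^sub>L real"
  assumes d: "\<And>x. (\<psi> has_derivative blinfun_apply (\<psi>' x)) (at x)" and C1: "C1_map \<psi>'"
    and K: "\<And>x. norm (\<psi>' x) \<le> K" and small: "K * norm e \<le> 1/2"
  shows "(\<lambda>x. x + \<psi> x *\<^sub>R e) \<in> Diff2"
proof -
  define F where "F = (\<lambda>x. x + \<psi> x *\<^sub>R e)"
  define G where "G = inv F"
  define R where "R = (\<lambda>x. blinfun_scaleR_left e o\<^sub>L \<psi>' x)"
  define N where "N = (\<lambda>x. id_blinfun - inverse (1 + \<psi>' x e) *\<^sub>R R x)"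
  have lip\<psi>: "norm (\<psi> x - \<psi> y) \<le> K * norm (x - y)" for x y
    using differentiable_bound[of UNIV \<psi> "\<lambda>x. blinfun_apply (\<psi>' x)" K x y] d K
    by (auto simp: norm_blinfun.rep_eq)
  \<comment> \<open>A displacement that contracts by 1/2 settles bijectivity twice over:
    \<open>expand\<close> gives injectivity and the Lipschitz constant 2 of the inverse, and the
    Banach fixed point of \<open>\<lambda>x. y - \<psi> x *\<^sub>R e\<close> is a preimage of
    \<open>y\<close>.\<close>
  have half: "norm (\<psi> x *\<^sub>R e - \<psi> y *\<^sub>R e) \<le> 1/2 * norm (x - y)" for x y
  proof -
    have "norm (\<psi> x *\<^sub>R e - \<psi> y *\<^sub>R e) = norm (\<psi> x - \<psi> y) * norm e"
      by (metis scaleR_left_diff_distrib norm_scaleR real_norm_def)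
    also have "\<dots> \<le> K * norm (x - y) * norm e"
      by (intro mult_right_mono lip\<psi>) auto
    also have "\<dots> = (K * norm e) * norm (x - y)" by simp
    also have "\<dots> \<le> 1/2 * norm (x - y)" by (intro mult_right_mono small) auto
    finally show ?thesis .
  qed
  have expand: "norm (x - y) \<le> 2 * norm (F x - F y)" for x y
  proof -
    have "x - y = (F x - F y) - (\<psi> x *\<^sub>R e - \<psi> y *\<^sub>R e)" by (simp add: F_def)
    then have "norm (x - y) \<le> norm (F x - F y) + norm (\<psi> x *\<^sub>R e - \<psi> y *\<^sub>R e)"
      by (metis norm_triangle_ineq4)
    with half[of x y] show ?thesis by simp
  qed
  have "inj F"
  proof (rule injI)
    fix x y assume "F x = F y"
    with expand[of x y] show "x = y" by simp
  qed
  moreover have "surj F"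
    unfolding surj_def
  proof
    fix y
    have "\<exists>!x. y - \<psi> x *\<^sub>R e = x"
      by (rule banach_fix_type[of "1/2"]) (use half in \<open>auto simp: dist_norm norm_minus_commute\<close>)
    then show "\<exists>x. y = F x" by (metis F_def diff_add_cancel)
  qed
  ultimately have bij: "bij F" by (simp add: bij_def)
  have FG: "F (G y) = y" for y by (simp add: G_def bij bij_is_surj surj_f_inv_f)
  \<comment> \<open>Continuity of \<open>G\<close> has to be known before the inverse can be
    differentiated, and it also starts the regularity argument for \<open>G\<close> below.\<close>
  have contG: "continuous_on UNIV G"
  proof (rule lipschitz_on_continuous_on)
    show "2-lipschitz_on UNIV G"
      by (rule lipschitz_onI) (use expand[of "G _" "G _"] in \<open>auto simp: dist_norm FG\<close>)
  qed
  have nz: "1 + \<psi>' x e \<noteq> 0" for x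
  proof -
    have "norm (\<psi>' x e) \<le> norm (\<psi>' x) * norm e" by (rule norm_blinfun)
    also have "\<dots> \<le> K * norm e" by (intro mult_right_mono K) auto
    finally show ?thesis using small by auto
  qed
  have C1R: "C1_map R" unfolding R_def
    by (intro C1_map_bilinear[OF bounded_bilinear_blinfun_compose] C1_map_const C1)
  have C1F': "C1_map (\<lambda>x. id_blinfun + R x)"
    by (intro C1_map_add C1_map_const C1R)
  have C1N: "C1_map N"
    unfolding N_def diff_conv_add_uminus
    by (intro C1_map_add C1_map_const C1_map_linear_compose[OF bounded_linear_minus[OF bounded_linear_ident]]
        C1_map_bilinear[OF bounded_bilinear_scaleR] C1R C1_map_real_inverse nz
        C1_map_linear_compose[OF blinfun.bounded_linear_left] C1)
  have F': "(F has_derivative blinfun_apply (id_blinfun + R x)) (at x)" for x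
    unfolding F_def
    by (rule has_derivative_eq_rhs, rule derivative_intros, rule has_derivative_ident,
        rule has_derivative_scaleR_left[OF d])
      (auto simp: plus_blinfun.rep_eq R_def)
  have NF: "N x (h + \<psi>' x h *\<^sub>R e) = h" for x h
  proof -
    have "N x v = v - (inverse (1 + \<psi>' x e) * \<psi>' x v) *\<^sub>R e" for v
      by (simp add: N_def R_def minus_blinfun.rep_eq scaleR_blinfun.rep_eq)
    moreover have "inverse (1 + \<psi>' x e) * \<psi>' x (h + \<psi>' x h *\<^sub>R e) = \<psi>' x h"
      using nz[of x] by (simp add: blinfun.bilinear_simps field_simps)
    ultimately show ?thesis by simp
  qed
  have G': "(G has_derivative blinfun_apply (N (G y))) (at y)" for y
    by (rule has_derivative_inverse_basic[OF F', where T=UNIV])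
      (use NF contG FG in \<open>auto simp: fun_eq_iff plus_blinfun.rep_eq R_def blinfun.bounded_linear_right
        continuous_on_eq_continuous_at\<close>)
  \<comment> \<open>Bootstrapping through \<open>G' = N o G\<close>: continuity of \<open>G\<close>
    makes this derivative continuous, so \<open>G\<close> is C^1; then the derivative is itself C^1,
    so \<open>G\<close> is C^2.\<close>
  have "C1_map G"
    by (rule C1_mapI[OF G'], rule continuous_on_compose2[OF C1_map_continuous[OF C1N] contG]) auto
  then have "C2_map G"
    by (intro C2_mapI[OF G'] C1_map_compose[OF C1N])
  moreover have "C2_map F"
    by (rule C2_mapI[OF F' C1F'])
  ultimately show ?thesis using bij by (simp add: Diff2_def G_def F_def)
qed

text \<open>Only the kink at 0 matters: there the difference quotient is at most
  \<open>max 0 h ^ Suc n\<close>, which tends to 0 because a positive power is left. The form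
  \<open>Suc (Suc n)\<close> guarantees exponent at least 2. The case \<open>n = 1\<close>
  differentiates the bump, and \<open>n = 0\<close> differentiates its derivative.\<close>

lemma has_derivative_trunc_power:
  "((\<lambda>s::real. max 0 s ^ Suc (Suc n)) has_real_derivative real (Suc (Suc n)) * max 0 s ^ Suc n) (at s)"
proof (cases s "0 :: real" rule: linorder_cases)
  case less
  have "((\<lambda>s::real. 0) has_real_derivative real (Suc (Suc n)) * max 0 s ^ Suc n) (at s)"
    using less by simp
  then show ?thesis
    by (rule has_field_derivative_transform_within_open[of _ _ _ "{..<0}"]) (use less in auto)
next
  case greater
  have "((\<lambda>s::real. s ^ Suc (Suc n)) has_real_derivative real (Suc (Suc n)) * max 0 s ^ Suc n) (at s)"
    by (rule DERIV_cong[OF DERIV_pow]) (use greater in simp)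
  then show ?thesis
    by (rule has_field_derivative_transform_within_open[of _ _ _ "{0<..}"]) (use greater in auto)
next
  case equal
  have "((\<lambda>h::real. max 0 h ^ Suc (Suc n) / h) \<longlongrightarrow> 0) (at 0)"
  proof (rule Lim_null_comparison)
    show "\<forall>\<^sub>F h in at 0. norm (max 0 h ^ Suc (Suc n) / h :: real) \<le> max 0 h ^ Suc n"
      by (rule eventuallyI) (auto simp: max_def)
    show "((\<lambda>h::real. max 0 h ^ Suc n) \<longlongrightarrow> 0) (at 0)"
      by (rule tendsto_eq_rhs, (rule tendsto_intros)+) auto
  qed
  then show ?thesis
    using equal by (simp add: DERIV_def)
qed

section \<open>A compactly supported bump with explicit derivative\<close>

lemma paraboloid_has_derivative:
  "((\<lambda>x::'a::real_inner. 1 - (norm (x - c))\<^sup>2 / r\<^sup>2) has_derivative (\<lambda>h. (- 2 / r\<^sup>2) * ((x - c) \<bullet> h))) (at x)"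
proof -
  have "((\<lambda>x. (norm (x - c))\<^sup>2) has_derivative (\<lambda>h. 2 * ((x - c) \<bullet> h))) (at x)"
    unfolding power2_norm_eq_inner
    by (auto intro!: derivative_eq_intros simp: fun_eq_iff inner_commute)
  then show ?thesis
    unfolding divide_inverse
    by (rule has_derivative_eq_rhs[OF has_derivative_diff[OF has_derivative_const has_derivative_mult_left]])
      (simp add: fun_eq_iff)
qed

text \<open>The exponent 3 is the smallest one making the truncated paraboloid \<open>C\<^sup>2\<close>.\<close>

definition bump :: "'a::euclidean_space \<Rightarrow> real \<Rightarrow> 'a \<Rightarrow> real" where
  "bump c r x = max 0 (1 - (norm (x - c))\<^sup>2 / r\<^sup>2) ^ 3"

definition bump' :: "'a::euclidean_space \<Rightarrow> real \<Rightarrow> 'a \<Rightarrow> 'a \<Rightarrow>\<^sub>L real" where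
  "bump' c r x = (3 * max 0 (1 - (norm (x - c))\<^sup>2 / r\<^sup>2) ^ 2 * (- 2 / r\<^sup>2)) *\<^sub>R blinfun_inner_right (x - c)"

lemma bump_has_derivative: "(bump c r has_derivative blinfun_apply (bump' c r x)) (at x)"
proof -
  have 1: "((\<lambda>x. 1 - (norm (x - c))\<^sup>2 / r\<^sup>2) has_derivative (\<lambda>h. (- 2 / r\<^sup>2) * ((x - c) \<bullet> h))) (at x)"
    by (rule paraboloid_has_derivative)
  have 2: "((\<lambda>s::real. max 0 s ^ 3) has_derivative
      (\<lambda>h. h * (3 * max 0 (1 - (norm (x - c))\<^sup>2 / r\<^sup>2) ^ 2))) (at (1 - (norm (x - c))\<^sup>2 / r\<^sup>2))"
    using has_derivative_trunc_power[of 1 "1 - (norm (x - c))\<^sup>2 / r\<^sup>2"]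
    by (simp add: has_field_derivative_def numeral_2_eq_2 numeral_3_eq_3 mult.commute[of _ "(3::real) * _"] mult_commute_abs)
  show ?thesis
    unfolding bump_def bump'_def
    by (rule has_derivative_eq_rhs[OF has_derivative_compose[OF 1 2]])
      (simp add: fun_eq_iff blinfun.bilinear_simps)
qed

text \<open>The derivative is a scalar profile of the paraboloid times an inner-product functional
  that is linear in \<open>x - c\<close>. Its profile is a truncated square, whose own derivative is
  a multiple of \<open>max 0 s\<close> and hence still continuous.\<close>

lemma C1_map_bump': "C1_map (bump' (c :: 'a::euclidean_space) r)"
proof -
  let ?q = "\<lambda>s::real. 3 * max 0 s ^ 2 * (- 2 / r\<^sup>2)"
  have "C1_map ?q"
  proof (rule C1_mapI)
    fix s :: real
    have "((\<lambda>s. max 0 s ^ 2) has_real_derivative 2 * max 0 s) (at s)"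
      using has_derivative_trunc_power[of 0 s] by (simp add: numeral_2_eq_2)
    from DERIV_cmult_right[OF DERIV_cmult[OF this, of 3], of "- 2 / r\<^sup>2"]
    have "(?q has_real_derivative (- 12 / r\<^sup>2) * max 0 s) (at s)"
      by (rule DERIV_cong) simp
    then show "(?q has_derivative blinfun_apply (((- 12 / r\<^sup>2) * max 0 s) *\<^sub>R id_blinfun)) (at s)"
      unfolding has_field_derivative_def
      by (rule has_derivative_eq_rhs) (simp add: fun_eq_iff blinfun.bilinear_simps)
  qed (intro continuous_intros)
  from C1_map_compose[OF this] have q: "C1_map g \<Longrightarrow> C1_map (\<lambda>x. ?q (g x))" for g :: "'a \<Rightarrow> real" .
  have "C1_map (\<lambda>x. 1 - (norm (x - c))\<^sup>2 / r\<^sup>2)"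
  proof (rule C1_mapI)
    show "((\<lambda>x. 1 - (norm (x - c))\<^sup>2 / r\<^sup>2) has_derivative
        blinfun_apply ((- 2 / r\<^sup>2) *\<^sub>R blinfun_inner_right (x - c))) (at x)" for x
      by (rule has_derivative_eq_rhs[OF paraboloid_has_derivative])
        (simp add: fun_eq_iff blinfun.bilinear_simps)
    show "continuous_on UNIV (\<lambda>x. (- 2 / r\<^sup>2) *\<^sub>R blinfun_inner_right (x - c))"
      by (intro continuous_intros bounded_linear.continuous_on[OF bounded_linear_blinfun_inner_right])
  qed
  from q[OF this] have 1: "C1_map (\<lambda>x. ?q (1 - (norm (x - c))\<^sup>2 / r\<^sup>2))" .
  have 2: "C1_map (\<lambda>x. x - c)"
    unfolding diff_conv_add_uminus
    by (intro C1_map_add C1_map_const C1_map_bounded_linear bounded_linear_ident)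
  show ?thesis
    unfolding bump'_def
    by (rule C1_map_bilinear[OF bounded_bilinear_scaleR 1
        C1_map_linear_compose[OF bounded_linear_blinfun_inner_right 2]])
qed

lemma bump_bounds: "0 \<le> bump c r x" "bump c r x \<le> 1"
  by (auto simp: bump_def intro!: power_le_one)

lemma bump_eq_0: "r > 0 \<Longrightarrow> r \<le> norm (x - c) \<Longrightarrow> bump c r x = 0"
  by (simp add: bump_def max_def field_simps)

lemma bump_center: "bump c r c = 1"
  by (simp add: bump_def)

lemma bump'_eq_0:
  assumes "r > 0" "r \<le> norm (x - c)"
  shows "bump' c r x = 0"
proof -
  have "(norm (x - c))\<^sup>2 / r\<^sup>2 \<ge> 1"
    using assms by simp
  then have "max 0 (1 - (norm (x - c))\<^sup>2 / r\<^sup>2) = 0"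
    by simp
  then show ?thesis unfolding bump'_def by simp
qed

text \<open>Inside the ball the factor 3 of the cube, the factor \<open>2 / r\<^sup>2\<close> of the
  paraboloid and \<open>norm (x - c) \<le> r\<close> multiply to \<open>6 / r\<close>; outside the
  derivative vanishes.\<close>

lemma norm_bump'_le:
  assumes "r > 0"
  shows "norm (bump' c r x) \<le> 6 / r"
proof (cases "norm (x - c) \<le> r")
  case True
  define m where "m = max 0 (1 - (norm (x - c))\<^sup>2 / r\<^sup>2)"
  have m: "0 \<le> m" "m ^ 2 \<le> 1" by (auto simp: m_def intro!: power_le_one)
  have "norm (bump' c r x) = (6 * m ^ 2 / r\<^sup>2) * norm (blinfun_inner_right (x - c))"
    by (simp add: bump'_def m_def)
  also have "\<dots> \<le> (6 * 1 / r\<^sup>2) * r"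
  proof (rule mult_mono)
    show "6 * m ^ 2 / r\<^sup>2 \<le> 6 * 1 / r\<^sup>2"
      by (rule divide_right_mono) (use m(2) in auto)
    have "norm (blinfun_inner_right (x - c)) \<le> norm (x - c)"
      by (rule norm_blinfun_bound) (simp_all add: Cauchy_Schwarz_ineq2)
    then show "norm (blinfun_inner_right (x - c)) \<le> r" using True by linarith
  qed auto
  also have "\<dots> = 6 / r" using assms by (simp add: power2_eq_square)
  finally show ?thesis .
next
  case False
  then show ?thesis using assms by (simp add: bump'_eq_0)
qed

section \<open>Integration by parts\<close>

text \<open>By translation invariance of \<^const>\<open>lborel\<close> the difference quotients integrate to 0; dominated
  convergence passes this to the derivative.\<close>

lemma integral_directional_derivative_compact_support:
  fixes f :: "'a::euclidean_space \<Rightarrow> real"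
  assumes d: "\<And>x. (f has_derivative f' x) (at x)"
    and cont: "continuous_on UNIV (\<lambda>x. f' x e)"
    and supp: "\<And>x. R < norm x \<Longrightarrow> f x = 0"
  shows "(\<integral>x. f' x e \<partial>lborel) = 0"
proof -
  define t where "t n = 1 / real (Suc n)" for n
  define s where "s n x = (f (x + t n *\<^sub>R e) - f x) / t n" for n x
  have t: "0 < t n" "t n \<le> 1" for n by (auto simp: t_def)
  have fc: "continuous_on A f" for A
    using d has_derivative_continuous_on has_derivative_at_withinI by blast
  have [measurable]: "f \<in> borel_measurable borel" "(\<lambda>x. f' x e) \<in> borel_measurable borel"
    using fc[of UNIV] cont by (auto intro: borel_measurable_continuous_onI)
  have "integrable lborel (\<lambda>x. indicator (cball 0 R) x *\<^sub>R f x)"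
    by (rule borel_integrable_compact[OF compact_cball fc])
  also have "(\<lambda>x. indicator (cball 0 R) x *\<^sub>R f x) = f"
    using supp by (auto simp: fun_eq_iff indicator_def)
  finally have fint: "integrable lborel f" .
  have trans: "integrable lborel (\<lambda>x. f (x + v))" "(\<integral>x. f (x + v) \<partial>lborel) = (\<integral>x. f x \<partial>lborel)" for v
  proof -
    have "integrable (distr lborel borel ((+) v)) f"
      using fint by (simp add: lborel_distr_plus)
    then show "integrable lborel (\<lambda>x. f (x + v))"
      by (simp add: integrable_distr_eq add.commute)
    have "(\<integral>x. f x \<partial>distr lborel borel ((+) v)) = (\<integral>x. f (v + x) \<partial>lborel)"
      by (rule integral_distr) auto
    then show "(\<integral>x. f (x + v) \<partial>lborel) = (\<integral>x. f x \<partial>lborel)"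
      by (simp add: lborel_distr_plus add.commute)
  qed
  have s0: "(\<integral>x. s n x \<partial>lborel) = 0" for n
    unfolding s_def using trans fint by simp
  \<comment> \<open>Since \<open>t n \<le> 1\<close>, the quotient \<open>s n\<close> vanishes
    outside the ball of radius \<open>R + norm e\<close>. The mean value point can lie another
    \<open>norm e\<close> further out, hence the radius on which the derivative is bounded.\<close>
  let ?K = "cball 0 (R + 2 * norm e) :: 'a set"
  obtain B where B: "\<And>x. x \<in> ?K \<Longrightarrow> norm (f' x e) \<le> B"
  proof -
    have "compact ((\<lambda>x. f' x e) ` ?K)"
      by (intro compact_continuous_image continuous_on_subset[OF cont]) auto
    then obtain B where "\<forall>x\<in>?K. norm (f' x e) \<le> B"
      by (auto dest!: compact_imp_bounded simp: bounded_iff)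
    then show ?thesis by (intro that) blast
  qed
  let ?w = "\<lambda>x. indicator (cball 0 (R + norm e) :: 'a set) x *\<^sub>R B"
  have bound: "norm (s n x) \<le> ?w x" for n x
  proof (cases "x \<in> cball 0 (R + norm e)")
    case True
    have "((\<lambda>u. f (x + u *\<^sub>R e)) has_derivative (\<lambda>h. h * f' (x + u *\<^sub>R e) e)) (at u)" for u
    proof -
      have "((\<lambda>u. f (x + u *\<^sub>R e)) has_derivative (\<lambda>h. f' (x + u *\<^sub>R e) (h *\<^sub>R e))) (at u)"
        by (rule has_derivative_compose[OF _ d]) (auto intro!: derivative_eq_intros)
      then show ?thesis
        by (simp add: linear_scale[OF has_derivative_linear[OF d]])
    qed
    then have "\<exists>u>0. u < t n \<and> f (x + t n *\<^sub>R e) - f (x + 0 *\<^sub>R e) = (t n - 0) * f' (x + u *\<^sub>R e) e"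
      using t(1)[of n] by (intro MVT2) (auto simp: has_field_derivative_def mult_commute_abs)
    then obtain u where u: "0 < u" "u < t n" "s n x = f' (x + u *\<^sub>R e) e"
      using t(1)[of n] by (auto simp: s_def)
    have "norm (x + u *\<^sub>R e) \<le> norm x + u * norm e"
      using u(1) by (metis norm_triangle_ineq norm_scaleR abs_of_pos)
    also have "\<dots> \<le> (R + norm e) + 1 * norm e"
      using True u t(2)[of n] by (intro add_mono mult_right_mono) auto
    finally show ?thesis
      using True u(3) B[of "x + u *\<^sub>R e"] by simp
  next
    case False
    then have x: "norm x > R + norm e" by simp
    have "norm x \<le> norm (x + t n *\<^sub>R e) + norm (t n *\<^sub>R e)"
      by (metis add_diff_cancel_right' norm_triangle_ineq4)
    moreover have "norm (t n *\<^sub>R e) \<le> 1 * norm e"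
      using t[of n] by (simp add: mult_left_le_one_le)
    ultimately have "norm (x + t n *\<^sub>R e) > R" using x by simp
    moreover have "norm x > R" using x norm_ge_zero[of e] by linarith
    ultimately show ?thesis using False supp by (simp add: s_def)
  qed
  have lim: "(\<lambda>n. s n x) \<longlonglongrightarrow> f' x e" for x
  proof -
    have "((\<lambda>u. (f (x + u *\<^sub>R e) - f x) / u) \<longlongrightarrow> f' x e) (at 0)"
    proof -
      have "((\<lambda>u. f (x + u *\<^sub>R e)) has_derivative (\<lambda>h. f' (x + 0 *\<^sub>R e) (h *\<^sub>R e))) (at 0)"
        by (rule has_derivative_compose[OF _ d]) (auto intro!: derivative_eq_intros)
      then have "((\<lambda>u. f (x + u *\<^sub>R e)) has_real_derivative f' x e) (at 0)"
        by (simp add: linear_scale[OF has_derivative_linear[OF d]] has_field_derivative_def mult_commute_abs)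
      then show ?thesis by (simp add: DERIV_def)
    qed
    moreover have "filterlim t (at 0) sequentially"
      unfolding filterlim_at t_def by (auto intro!: LIMSEQ_Suc[OF lim_1_over_n] simp del: of_nat_Suc)
    ultimately show ?thesis
      unfolding s_def by (rule filterlim_compose)
  qed
  have "(\<lambda>n. \<integral>x. s n x \<partial>lborel) \<longlonglongrightarrow> (\<integral>x. f' x e \<partial>lborel)"
  proof (rule integral_dominated_convergence)
    show "integrable lborel ?w"
      by (rule borel_integrable_compact) auto
    show "s n \<in> borel_measurable lborel" for n
      unfolding s_def by measurable
  qed (use lim bound in auto)
  then show ?thesis by (simp add: s0 LIMSEQ_const_iff)
qed

section \<open>Gradients and divergences in coordinates\<close>

lemma GDERIV_unique:
  fixes f :: "'a::euclidean_space \<Rightarrow> real"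
  assumes "GDERIV f x :> g" "GDERIV f x :> g'"
  shows "g = g'"
proof -
  have "(\<lambda>h. h \<bullet> g) = (\<lambda>h. h \<bullet> g')"
    using assms unfolding gderiv_def by (rule has_derivative_unique)
  then have "b \<bullet> g = b \<bullet> g'" for b
    by (rule fun_cong)
  then have "g \<bullet> b = g' \<bullet> b" for b
    by (simp only: inner_commute[of g] inner_commute[of g'])
  from euclidean_eqI[OF this] show ?thesis .
qed

lemma gradient_eqI:
  fixes f :: "'a::euclidean_space \<Rightarrow> real"
  assumes "GDERIV f x :> g"
  shows "gradient f x = g"
  unfolding gradient_def
proof (rule the_equality)
  show "g' = g" if "GDERIV f x :> g'" for g'
    using that assms by (rule GDERIV_unique)
qed (rule assms)

text \<open>Riesz representation in the orthonormal basis. The explicit vector makes the gradient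
  depend continuously on the derivative.\<close>

lemma GDERIV_blinfun:
  fixes f :: "'a::euclidean_space \<Rightarrow> real"
  assumes "(f has_derivative blinfun_apply f') (at x)"
  shows "GDERIV f x :> (\<Sum>b\<in>Basis. blinfun_apply f' b *\<^sub>R b)"
  unfolding gderiv_def
proof (rule has_derivative_eq_rhs[OF assms])
  have "blinfun_apply f' h = h \<bullet> (\<Sum>b\<in>Basis. blinfun_apply f' b *\<^sub>R b)" for h
  proof -
    have "blinfun_apply f' h = blinfun_apply f' (\<Sum>b\<in>Basis. (h \<bullet> b) *\<^sub>R b)"
      by (simp add: euclidean_representation)
    also have "\<dots> = h \<bullet> (\<Sum>b\<in>Basis. blinfun_apply f' b *\<^sub>R b)"
      by (simp add: blinfun.bilinear_simps blinfun.sum_right inner_sum_right mult.commute)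
    finally show ?thesis .
  qed
  then show "blinfun_apply f' = (\<lambda>h. h \<bullet> (\<Sum>b\<in>Basis. blinfun_apply f' b *\<^sub>R b))" by (rule ext)
qed

lemma GDERIV_gradient:
  fixes f :: "'a::euclidean_space \<Rightarrow> real"
  assumes "C1_map f"
  shows "GDERIV f x :> gradient f x"
proof -
  obtain f' where f: "\<And>x. (f has_derivative blinfun_apply (f' x)) (at x)"
    using assms unfolding C1_map_def by blast
  show ?thesis
    unfolding gradient_eqI[OF GDERIV_blinfun[OF f]] by (rule GDERIV_blinfun[OF f])
qed

lemma continuous_on_gradient:
  fixes f :: "'a::euclidean_space \<Rightarrow> real"
  assumes "C1_map f"
  shows "continuous_on UNIV (gradient f)"
proof -
  obtain f' where f: "\<And>x. (f has_derivative blinfun_apply (f' x)) (at x)" "continuous_on UNIV f'"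
    using assms unfolding C1_map_def by blast
  have "gradient f = (\<lambda>x. \<Sum>b\<in>Basis. blinfun_apply (f' x) b *\<^sub>R b)"
    by (rule ext) (rule gradient_eqI[OF GDERIV_blinfun[OF f(1)]])
  then show ?thesis using f(2) by (auto intro!: continuous_intros)
qed

lemma gradient_ln:
  fixes p :: "'a::euclidean_space \<Rightarrow> real"
  assumes "C1_map p" "p x > 0"
  shows "gradient (\<lambda>y. ln (p y)) x = inverse (p x) *\<^sub>R gradient p x"
  by (intro gradient_eqI GDERIV_DERIV_compose[OF GDERIV_gradient[OF assms(1)]] DERIV_ln assms(2))

lemma linear_sum_axis:
  fixes f :: "real^'n \<Rightarrow> 'b::real_vector"
  assumes "linear f"
  shows "f v = (\<Sum>i\<in>UNIV. (v $ i) *\<^sub>R f (axis i 1))"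
proof -
  have "f v = f (\<Sum>i\<in>UNIV. (v $ i) *\<^sub>R axis i 1)"
    using basis_expansion[of v] by (simp add: scalar_mult_eq_scaleR)
  then show ?thesis by (simp add: linear_sum[OF assms] linear_scale[OF assms])
qed

lemma divergence_eq:
  assumes "(\<phi> has_derivative \<phi>') (at x)"
  shows "divergence \<phi> x = (\<Sum>i\<in>UNIV. \<phi>' (axis i 1) $ i)"
  using frechet_derivative_at[OF assms]
  by (simp add: divergence_def trace_def jacobian_def matrix_def)

lemma continuous_on_divergence:
  fixes \<phi> :: "real^'n \<Rightarrow> real^'n"
  assumes "C1_map \<phi>"
  shows "continuous_on UNIV (divergence \<phi>)"
proof -
  obtain \<phi>' where f: "\<And>x. (\<phi> has_derivative blinfun_apply (\<phi>' x)) (at x)" "continuous_on UNIV \<phi>'"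
    using assms unfolding C1_map_def by blast
  have "divergence \<phi> = (\<lambda>x. \<Sum>i\<in>UNIV. blinfun_apply (\<phi>' x) (axis i 1) $ i)"
    by (rule ext) (rule divergence_eq[OF f(1)])
  then show ?thesis using f(2) by (auto intro!: continuous_intros)
qed

text \<open>For the field \<open>q v\<close> multiplied by a cut-off, the integral of the divergence
  is 0. As the radius grows, the assumptions \<open>int1\<close> and \<open>int2\<close> dominate
  the part where the cut-off is not differentiated. The part where it is differentiated is at most a
  multiple of \<open>norm (q x *\<^sub>R v x)\<close> tending to 0, and is dominated by
  \<open>int3\<close>.\<close>

lemma integral_by_parts_divergence:
  fixes q :: "real^'n \<Rightarrow> real" and v :: "real^'n \<Rightarrow> real^'n"
  assumes q: "C1_map q" and v: "C1_map v"
    and int1: "integrable lborel (\<lambda>x. q x * divergence v x)"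
    and int2: "integrable lborel (\<lambda>x. v x \<bullet> gradient q x)"
    and int3: "integrable lborel (\<lambda>x. q x *\<^sub>R v x)"
  shows "(\<integral>x. q x * divergence v x \<partial>lborel) = - (\<integral>x. v x \<bullet> gradient q x \<partial>lborel)"
proof -
  obtain q' where q': "\<And>x. (q has_derivative blinfun_apply (q' x)) (at x)" "continuous_on UNIV q'"
    using q unfolding C1_map_def by blast
  obtain v' where v': "\<And>x. (v has_derivative blinfun_apply (v' x)) (at x)" "continuous_on UNIV v'"
    using v unfolding C1_map_def by blast
  note cont = C1_map_continuous[OF q] C1_map_continuous[OF v]
  have q'v: "blinfun_apply (q' x) h = h \<bullet> gradient q x" for x h
    using fun_cong[OF has_derivative_unique[OF q'(1) GDERIV_gradient[OF q, unfolded gderiv_def]]] .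
  define \<omega> where "\<omega> n = bump (0 :: real^'n) (real (Suc n))" for n
  define \<omega>' where "\<omega>' n = bump' (0 :: real^'n) (real (Suc n))" for n
  \<comment> \<open>\<open>u n\<close> is the divergence of the field
    \<open>\<omega> n x *\<^sub>R (q x *\<^sub>R v x)\<close>; its last summand is the error caused
    by the cut-off.\<close>
  define u where "u n x = \<omega> n x * (q x * divergence v x + v x \<bullet> gradient q x) + \<omega>' n x (q x *\<^sub>R v x)" for n x
  have \<omega>': "(\<omega> n has_derivative blinfun_apply (\<omega>' n x)) (at x)" for n x
    unfolding \<omega>_def \<omega>'_def by (rule bump_has_derivative)
  have contb: "continuous_on UNIV (\<omega> n)" "continuous_on UNIV (\<omega>' n)" for n
  proof -
    show c: "continuous_on UNIV (\<omega>' n)"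
      unfolding \<omega>'_def by (rule C1_map_continuous[OF C1_map_bump'])
    show "continuous_on UNIV (\<omega> n)"
      by (rule C1_map_continuous[OF C1_mapI[OF \<omega>' c]])
  qed
  have u0: "(\<integral>x. u n x \<partial>lborel) = 0" for n
  proof -
    \<comment> \<open>\<open>F i x\<close> is the derivative of the \<open>i\<close>-th component of
      the truncated field, so \<open>F i x (axis i 1)\<close> is the \<open>i\<close>-th summand of
      its divergence.\<close>
    define F where "F i x h = (\<omega> n x * q x) * (v' x h $ i) + (\<omega> n x * q' x h + \<omega>' n x h * q x) * v x $ i"
      for i x h
    have "((\<lambda>x. \<omega> n x * q x * (v x $ i)) has_derivative F i x) (at x)" for i x
      unfolding F_def
      by (intro has_derivative_mult \<omega>' q' bounded_linear.has_derivative[OF bounded_linear_vec_nth v'(1)])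
    moreover have Fc: "continuous_on UNIV (\<lambda>x. F i x (axis i 1))" for i
      unfolding F_def using cont contb q'(2) v'(2) by (intro continuous_intros)
    moreover have z: "\<omega> n x = 0" "\<omega>' n x = 0" if "real (Suc n) < norm x" for x
      using that by (auto simp: \<omega>_def \<omega>'_def intro!: bump_eq_0 bump'_eq_0 simp del: of_nat_Suc)
    ultimately have F0: "(\<integral>x. F i x (axis i 1) \<partial>lborel) = 0" for i
      by (intro integral_directional_derivative_compact_support[where f="\<lambda>x. \<omega> n x * q x * (v x $ i)"]) auto
    \<comment> \<open>\<open>F i\<close> vanishes outside the ball, so the indicator changes
      nothing. Integrability of each summand is what allows the integral to be split over
      \<open>i\<close>.\<close>
    have "integrable lborel (\<lambda>x. indicator (cball 0 (real (Suc n))) x *\<^sub>R F i x (axis i 1))" for i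
      by (rule borel_integrable_compact[OF compact_cball continuous_on_subset[OF Fc]]) simp
    also have "(\<lambda>x. indicator (cball 0 (real (Suc n))) x *\<^sub>R F i x (axis i 1)) = (\<lambda>x. F i x (axis i 1))" for i
      using z by (auto simp: fun_eq_iff indicator_def F_def not_le)
    finally have Fi: "integrable lborel (\<lambda>x. F i x (axis i 1))" for i .
    have "u n x = (\<Sum>i\<in>UNIV. F i x (axis i 1))" for x
    proof -
      have "(\<Sum>i\<in>UNIV. F i x (axis i 1)) = \<omega> n x * (q x * (\<Sum>i\<in>UNIV. v' x (axis i 1) $ i)
          + (\<Sum>i\<in>UNIV. (v x $ i) *\<^sub>R q' x (axis i 1))) + q x * (\<Sum>i\<in>UNIV. (v x $ i) *\<^sub>R \<omega>' n x (axis i 1))"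
        by (simp add: F_def sum.distrib sum_distrib_left algebra_simps)
      also have "\<dots> = \<omega> n x * (q x * divergence v x + q' x (v x)) + q x * \<omega>' n x (v x)"
        by (simp only: divergence_eq[OF v'(1)]
            linear_sum_axis[OF bounded_linear.linear[OF blinfun.bounded_linear_right], of "q' x" "v x"]
            linear_sum_axis[OF bounded_linear.linear[OF blinfun.bounded_linear_right], of "\<omega>' n x" "v x"])
      finally show ?thesis by (simp add: u_def q'v blinfun.bilinear_simps)
    qed
    then show ?thesis using F0 Fi by simp
  qed
  have [measurable]: "q \<in> borel_measurable borel" "v \<in> borel_measurable borel"
    "divergence v \<in> borel_measurable borel" "gradient q \<in> borel_measurable borel"
    using cont continuous_on_divergence[OF v] continuous_on_gradient[OF q]
    by (auto intro: borel_measurable_continuous_onI)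
  have "(\<lambda>n. \<integral>x. u n x \<partial>lborel) \<longlonglongrightarrow> (\<integral>x. q x * divergence v x + v x \<bullet> gradient q x \<partial>lborel)"
  proof (rule integral_dominated_convergence)
    \<comment> \<open>The factor 6 is the bound \<open>6 / real (Suc n)\<close> taken at its
      largest, \<open>n = 0\<close>, so that one function dominates all \<open>u n\<close>.\<close>
    let ?w = "\<lambda>x. norm (q x * divergence v x) + norm (v x \<bullet> gradient q x) + 6 * norm (q x *\<^sub>R v x)"
    show "(\<lambda>x. q x * divergence v x + v x \<bullet> gradient q x) \<in> borel_measurable lborel"
      by measurable
    show "integrable lborel ?w"
      by (intro Bochner_Integration.integrable_add integrable_mult_right integrable_norm int1 int2 int3)
    show "u n \<in> borel_measurable lborel" for n
    proof -
      have "u n \<in> borel_measurable borel"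
        unfolding u_def
        by (intro borel_measurable_continuous_onI continuous_intros contb cont continuous_on_divergence[OF v]
            continuous_on_gradient[OF q])
      then show ?thesis by simp
    qed
    have small: "norm (\<omega>' n x h) \<le> 6 / real (Suc n) * norm h" for n x h
    proof -
      have "norm (\<omega>' n x h) \<le> norm (\<omega>' n x) * norm h" by (rule norm_blinfun)
      also have "\<dots> \<le> 6 / real (Suc n) * norm h"
        unfolding \<omega>'_def by (intro mult_right_mono norm_bump'_le) auto
      finally show ?thesis .
    qed
    show "AE x in lborel. norm (u n x) \<le> ?w x" for n
    proof (rule AE_I2)
      fix x :: "real^'n"
      have "norm (\<omega> n x * (q x * divergence v x + v x \<bullet> gradient q x))
          \<le> 1 * norm (q x * divergence v x + v x \<bullet> gradient q x)"
        unfolding norm_mult using bump_bounds[of "0::real^'n" "real (Suc n)" x]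
        by (intro mult_right_mono) (auto simp: \<omega>_def)
      moreover have "norm (\<omega>' n x (q x *\<^sub>R v x)) \<le> 6 * norm (q x *\<^sub>R v x)"
        by (rule order_trans[OF small]) (intro mult_right_mono, auto simp: field_simps)
      ultimately have "norm (u n x) \<le> 1 * norm (q x * divergence v x + v x \<bullet> gradient q x)
          + 6 * norm (q x *\<^sub>R v x)"
        unfolding u_def by (rule order_trans[OF norm_triangle_ineq add_mono])
      also have "\<dots> \<le> ?w x"
        by (intro add_mono) (simp_all add: abs_triangle_ineq)
      finally show "norm (u n x) \<le> ?w x" .
    qed
    show "AE x in lborel. (\<lambda>n. u n x) \<longlonglongrightarrow> q x * divergence v x + v x \<bullet> gradient q x"
    proof (rule AE_I2)
      fix x :: "real^'n"
      have "(\<lambda>n. 1 / real (Suc n)) \<longlonglongrightarrow> 0"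
        using LIMSEQ_Suc[OF lim_1_over_n] .
      then have "(\<lambda>n. max 0 (1 - (norm x * (1 / real (Suc n)))\<^sup>2) ^ 3) \<longlonglongrightarrow> max 0 (1 - (norm x * 0)\<^sup>2) ^ 3"
        by (intro tendsto_intros)
      then have "(\<lambda>n. \<omega> n x) \<longlonglongrightarrow> 1"
        by (simp add: \<omega>_def bump_def power_divide)
      moreover have "(\<lambda>n. \<omega>' n x (q x *\<^sub>R v x)) \<longlonglongrightarrow> 0"
      proof (rule Lim_null_comparison[OF always_eventually])
        show "\<forall>n. norm (\<omega>' n x (q x *\<^sub>R v x)) \<le> 6 / real (Suc n) * norm (q x *\<^sub>R v x)"
          using small by blast
        have "(\<lambda>n. 6 * (1 / real (Suc n)) * norm (q x *\<^sub>R v x)) \<longlonglongrightarrow> 6 * 0 * norm (q x *\<^sub>R v x)"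
          by (intro tendsto_intros LIMSEQ_Suc[OF lim_1_over_n])
        then show "(\<lambda>n. 6 / real (Suc n) * norm (q x *\<^sub>R v x)) \<longlonglongrightarrow> 0" by simp
      qed
      ultimately have "(\<lambda>n. u n x) \<longlonglongrightarrow> 1 * (q x * divergence v x + v x \<bullet> gradient q x) + 0"
        unfolding u_def by (intro tendsto_intros)
      then show "(\<lambda>n. u n x) \<longlonglongrightarrow> q x * divergence v x + v x \<bullet> gradient q x" by simp
    qed
  qed
  then have "(\<integral>x. q x * divergence v x + v x \<bullet> gradient q x \<partial>lborel) = 0"
    by (simp add: u0 LIMSEQ_const_iff)
  then show ?thesis using int1 int2 by simp
qed

section \<open>Gaussian noise and the loss\<close>

text \<open>Lebesgue measure is the image of the product of one-dimensional Lebesgue measures under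
  the coordinate expansion, so an integrand that factors over the coordinates has an integral that
  factors too.\<close>

lemma lborel_prod_Basis:
  fixes f :: "'a::euclidean_space \<Rightarrow> real \<Rightarrow> real"
  assumes "\<And>b. b \<in> Basis \<Longrightarrow> integrable lborel (f b)"
  shows "integrable lborel (\<lambda>x::'a. \<Prod>b\<in>Basis. f b (x \<bullet> b))"
    and "(\<integral>x. (\<Prod>b\<in>Basis. f b (x \<bullet> b)) \<partial>lborel) = (\<Prod>b\<in>Basis. (\<integral>s. f b s \<partial>lborel))"
proof -
  interpret product_sigma_finite "\<lambda>_::'a. lborel :: real measure" ..
  let ?P = "\<Pi>\<^sub>M b\<in>(Basis :: 'a set). (lborel :: real measure)"
  let ?T = "\<lambda>f. \<Sum>b\<in>(Basis :: 'a set). f b *\<^sub>R b"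
  let ?h = "\<lambda>x::'a. \<Prod>b\<in>Basis. f b (x \<bullet> b)"
  have [measurable]: "?T \<in> measurable ?P borel" by measurable
  have meas: "?h \<in> borel_measurable borel"
  proof (rule borel_measurable_prod)
    fix b :: 'a assume "b \<in> Basis"
    then have [measurable]: "f b \<in> borel_measurable borel" using assms by force
    show "(\<lambda>x. f b (x \<bullet> b)) \<in> borel_measurable borel" by measurable
  qed
  have eq: "?h (?T g) = (\<Prod>b\<in>Basis. f b (g b))" for g
    by (intro prod.cong) (auto simp: inner_sum_left inner_Basis if_distrib sum.delta cong: if_cong)
  have "integrable ?P (\<lambda>g. ?h (?T g))"
    unfolding eq by (intro product_integrable_prod assms) auto
  then show "integrable lborel ?h"
    by (subst lborel_eq) (simp add: integrable_distr_eq meas)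
  have "integral\<^sup>L lborel ?h = (\<integral>g. ?h (?T g) \<partial>?P)"
    by (subst lborel_eq) (simp add: integral_distr meas)
  also have "\<dots> = (\<Prod>b\<in>Basis. (\<integral>s. f b s \<partial>lborel))"
    unfolding eq by (intro product_integral_prod assms) auto
  finally show "integral\<^sup>L lborel ?h = (\<Prod>b\<in>Basis. (\<integral>s. f b s \<partial>lborel))" .
qed

text \<open>All coordinates except \<open>i\<close> integrate to 1, leaving a one-dimensional
  moment. Keeping \<open>k\<close> general gives total mass for \<open>k = 0\<close>, the mean for
  \<open>k = 1\<close> and the finite second moment for \<open>k = 2\<close>.\<close>

lemma gaussian_noise_moment:
  fixes i :: "'m::finite"
  assumes "\<delta> > 0"
  shows "integrable (gaussian_noise \<delta> :: (real^'m) measure) (\<lambda>\<eta>. (\<eta> $ i) ^ k)"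
    and "(\<integral>\<eta>. (\<eta> $ i) ^ k \<partial>(gaussian_noise \<delta> :: (real^'m) measure)) = (\<integral>s. normal_density 0 \<delta> s * s ^ k \<partial>lborel)"
proof -
  define f where "f b s = normal_density 0 \<delta> s * (if b = axis i 1 then s ^ k else 1)" for b :: "real^'m" and s
  have int: "integrable lborel (\<lambda>s. f b s)" for b
    using integrable_normal_moment[OF assms, of 0 k] integrable_normal_density[OF assms, of 0]
    by (cases "b = axis i 1") (simp_all add: f_def)
  have prod_axis: "(\<Prod>b\<in>Basis. g b (\<eta> \<bullet> b)) = (\<Prod>j\<in>UNIV. g (axis j 1) (\<eta> $ j))"
    for g and \<eta> :: "real^'m"
  proof -
    have B: "(Basis :: (real^'m) set) = (\<lambda>j. axis j 1) ` UNIV" by (auto simp: Basis_vec_def)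
    have "inj (\<lambda>j::'m. axis j (1::real))" by (auto simp: inj_def axis_eq_axis)
    then show ?thesis unfolding B by (subst prod.reindex) (simp_all add: inner_axis)
  qed
  have eq: "(\<Prod>j\<in>UNIV. normal_density 0 \<delta> (\<eta> $ j)) * (\<eta> $ i) ^ k = (\<Prod>b\<in>Basis. f b (\<eta> \<bullet> b))"
    for \<eta> :: "real^'m"
  proof -
    have "(\<Prod>b\<in>Basis. f b (\<eta> \<bullet> b)) = (\<Prod>j\<in>UNIV. normal_density 0 \<delta> (\<eta> $ j) * (if j = i then (\<eta> $ i) ^ k else 1))"
      unfolding prod_axis[of f] by (intro prod.cong) (auto simp: f_def axis_eq_axis)
    also have "\<dots> = (\<Prod>j\<in>UNIV. normal_density 0 \<delta> (\<eta> $ j)) * (\<eta> $ i) ^ k"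
      unfolding prod.distrib by (subst prod.delta) auto
    finally show ?thesis by (rule sym)
  qed
  note L = lborel_prod_Basis[of f, OF int]
  let ?D = "\<lambda>\<eta> :: real^'m. \<Prod>j\<in>UNIV. normal_density 0 \<delta> (\<eta> $ j)"
  have nn: "0 \<le> ?D \<eta>" for \<eta>
    by (intro prod_nonneg) simp
  have D: "?D \<in> borel_measurable lborel"
    by measurable
  have m: "(\<lambda>\<eta> :: real^'m. (\<eta> $ i) ^ k) \<in> borel_measurable lborel"
    by measurable
  show "integrable (gaussian_noise \<delta> :: (real^'m) measure) (\<lambda>\<eta>. (\<eta> $ i) ^ k)"
    unfolding gaussian_noise_def integrable_density[OF m D AE_I2[OF nn]]
    using L(1) by (simp only: real_scaleR_def eq)
  have "(\<integral>\<eta>. (\<eta> $ i) ^ k \<partial>(gaussian_noise \<delta> :: (real^'m) measure)) = (\<Prod>b\<in>Basis. (\<integral>s. f b s \<partial>lborel))"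
    unfolding gaussian_noise_def integral_density[OF m D AE_I2[OF nn]]
    using L(2) by (simp only: real_scaleR_def eq)
  also have "\<dots> = (\<Prod>b\<in>(Basis::(real^'m) set). if b = axis i 1 then (\<integral>s. normal_density 0 \<delta> s * s ^ k \<partial>lborel) else 1)"
    using assms by (intro prod.cong) (auto simp: f_def)
  also have "\<dots> = (\<integral>s. normal_density 0 \<delta> s * s ^ k \<partial>lborel)"
    by (subst prod.delta) auto
  finally show "(\<integral>\<eta>. (\<eta> $ i) ^ k \<partial>(gaussian_noise \<delta> :: (real^'m) measure)) = (\<integral>s. normal_density 0 \<delta> s * s ^ k \<partial>lborel)" .
qed

section \<open>The noise as a centred probability measure with finite second moments\<close>

lemma sets_prior [measurable_cong, simp]: "sets (prior p) = sets borel"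
  by (simp add: prior_def)

lemma space_prior [simp]: "space (prior p) = UNIV"
  by (simp add: prior_def)

lemma sets_gaussian_noise [measurable_cong, simp]: "sets (gaussian_noise \<delta>) = sets borel"
  by (simp add: gaussian_noise_def)

lemma space_gaussian_noise [simp]: "space (gaussian_noise \<delta>) = UNIV"
  by (simp add: gaussian_noise_def)

lemma prob_space_gaussian_noise:
  assumes "\<delta> > 0"
  shows "prob_space (gaussian_noise \<delta> :: (real^'m) measure)"
proof (rule prob_spaceI)
  let ?N = "gaussian_noise \<delta> :: (real^'m) measure"
  have "(\<integral>_. (1::real) \<partial>?N) = 1"
    using gaussian_noise_moment(2)[OF assms, where k=0 and ?'m='m] integral_normal_density[OF assms, of 0]
    by simp
  then have m: "measure ?N (space ?N) = 1" by simp
  \<comment> \<open>\<open>measure\<close> takes the default value 0 on a set of infinite mass, so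
    the value 1 excludes that case.\<close>
  then have "emeasure ?N (space ?N) \<noteq> \<infinity>"
    by (auto simp: measure_def)
  then show "emeasure ?N (space ?N) = 1"
    using m by (simp add: emeasure_eq_ennreal_measure)
qed

lemma linear_borel_measurable:
  fixes f :: "'a::euclidean_space \<Rightarrow> 'b::euclidean_space"
  shows "linear f \<Longrightarrow> f \<in> borel_measurable borel"
  by (intro borel_measurable_continuous_onI linear_continuous_on) (simp add: linear_conv_bounded_linear)

lemma gaussian_noise_linear_functional:
  fixes f :: "real^'m \<Rightarrow> real"
  assumes "\<delta> > 0" "linear f"
  shows "integrable (gaussian_noise \<delta>) f" "(\<integral>\<eta>. f \<eta> \<partial>gaussian_noise \<delta>) = 0"
proof -
  have f: "f = (\<lambda>\<eta>. \<Sum>i\<in>UNIV. (\<eta> $ i) *\<^sub>R f (axis i 1))"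
    by (rule ext) (rule linear_sum_axis[OF assms(2)])
  have int: "integrable (gaussian_noise \<delta>) (\<lambda>\<eta>. \<eta> $ i)" "(\<integral>\<eta>. \<eta> $ i \<partial>gaussian_noise \<delta>) = 0" for i :: 'm
    using gaussian_noise_moment[OF assms(1), of i 1] integral_normal_moment_nz_1[OF assms(1), of 0]
    by simp_all
  show "integrable (gaussian_noise \<delta>) f"
    by (subst f) (intro Bochner_Integration.integrable_sum integrable_scaleR_left int)
  show "(\<integral>\<eta>. f \<eta> \<partial>gaussian_noise \<delta>) = 0"
    by (subst f) (simp add: int)
qed

lemma gaussian_noise_linear_norm_sq:
  fixes L :: "real^'m \<Rightarrow> real^'n"
  assumes "\<delta> > 0" "linear L"
  shows "integrable (gaussian_noise \<delta>) (\<lambda>\<eta>. (norm (L \<eta>))\<^sup>2)"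
proof -
  obtain K where K: "norm (L \<eta>) \<le> norm \<eta> * K" for \<eta>
    using assms(2) bounded_linear.bounded linear_conv_bounded_linear by metis
  have [measurable]: "L \<in> borel_measurable borel"
    using assms(2) by (rule linear_borel_measurable)
  show ?thesis
  proof (rule Bochner_Integration.integrable_bound)
    show "integrable (gaussian_noise \<delta>) (\<lambda>\<eta>::real^'m. (\<Sum>i\<in>UNIV. (\<eta> $ i) ^ 2) * K\<^sup>2)"
      by (intro integrable_mult_left Bochner_Integration.integrable_sum gaussian_noise_moment assms(1))
    show "AE \<eta> in gaussian_noise \<delta>. norm ((norm (L \<eta>))\<^sup>2) \<le> norm ((\<Sum>i\<in>UNIV. (\<eta> $ i) ^ 2) * K\<^sup>2)"
    proof (rule AE_I2)
      fix \<eta> :: "real^'m"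
      have "(norm (L \<eta>))\<^sup>2 \<le> (norm \<eta> * K)\<^sup>2"
        by (intro power_mono K) simp
      also have "\<dots> = (\<Sum>i\<in>UNIV. (\<eta> $ i) ^ 2) * K\<^sup>2"
        by (simp add: power_mult_distrib norm_vec_def L2_set_def sum_nonneg)
      finally show "norm ((norm (L \<eta>))\<^sup>2) \<le> norm ((\<Sum>i\<in>UNIV. (\<eta> $ i) ^ 2) * K\<^sup>2)"
        by (simp add: sum_nonneg)
    qed
  qed measurable
qed

section \<open>Square-integrable vector fields\<close>

lemma norm_diff_sq: "(norm (a - b :: 'a::real_inner))\<^sup>2 = (norm a)\<^sup>2 - 2 * (a \<bullet> b) + (norm b)\<^sup>2"
  by (simp add: power2_norm_eq_inner inner_diff_left inner_diff_right inner_commute)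

text \<open>Cauchy-Schwarz followed by the arithmetic-geometric mean inequality gives a pointwise
  integrable bound.\<close>

lemma integrable_inner_sq:
  fixes f g :: "'a \<Rightarrow> 'b::euclidean_space"
  assumes [measurable]: "f \<in> borel_measurable M" "g \<in> borel_measurable M"
    and "integrable M (\<lambda>x. (norm (f x))\<^sup>2)" "integrable M (\<lambda>x. (norm (g x))\<^sup>2)"
  shows "integrable M (\<lambda>x. f x \<bullet> g x)"
proof (rule Bochner_Integration.integrable_bound)
  show "integrable M (\<lambda>x. (norm (f x))\<^sup>2 + (norm (g x))\<^sup>2)"
    using assms by simp
  show "AE x in M. norm (f x \<bullet> g x) \<le> norm ((norm (f x))\<^sup>2 + (norm (g x))\<^sup>2)"
  proof (rule AE_I2)
    fix x
    have "norm (f x \<bullet> g x) \<le> norm (f x) * norm (g x)"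
      using Cauchy_Schwarz_ineq2 by simp
    also have "2 * (norm (f x) * norm (g x)) \<le> (norm (f x))\<^sup>2 + (norm (g x))\<^sup>2"
      using sum_squares_bound[of "norm (f x)" "norm (g x)"] by simp
    then have "norm (f x) * norm (g x) \<le> (norm (f x))\<^sup>2 + (norm (g x))\<^sup>2"
      by (smt (verit) mult_nonneg_nonneg norm_ge_zero)
    finally show "norm (f x \<bullet> g x) \<le> norm ((norm (f x))\<^sup>2 + (norm (g x))\<^sup>2)" by simp
  qed
qed measurable

lemma integrable_diff_sq:
  fixes f g :: "'a \<Rightarrow> 'b::euclidean_space"
  assumes "f \<in> borel_measurable M" "g \<in> borel_measurable M"
    and "integrable M (\<lambda>x. (norm (f x))\<^sup>2)" "integrable M (\<lambda>x. (norm (g x))\<^sup>2)"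
  shows "integrable M (\<lambda>x. (norm (f x - g x))\<^sup>2)"
  unfolding norm_diff_sq using assms integrable_inner_sq[OF assms] by simp

lemma integrable_linear_sq:
  fixes f :: "'a \<Rightarrow> 'b::euclidean_space" and L :: "'b \<Rightarrow> 'c::euclidean_space"
  assumes "linear L" and [measurable]: "f \<in> borel_measurable M"
    and "integrable M (\<lambda>x. (norm (f x))\<^sup>2)"
  shows "integrable M (\<lambda>x. (norm (L (f x)))\<^sup>2)"
proof -
  obtain K where K: "norm (L y) \<le> norm y * K" for y
    using assms(1) bounded_linear.bounded linear_conv_bounded_linear by metis
  have [measurable]: "L \<in> borel_measurable borel"
    using assms(1) by (rule linear_borel_measurable)
  show ?thesis
  proof (rule Bochner_Integration.integrable_bound)
    show "integrable M (\<lambda>x. (norm (f x))\<^sup>2 * K\<^sup>2)"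
      using assms(3) by simp
    show "AE x in M. norm ((norm (L (f x)))\<^sup>2) \<le> norm ((norm (f x))\<^sup>2 * K\<^sup>2)"
    proof (rule AE_I2)
      fix x
      have "(norm (L (f x)))\<^sup>2 \<le> (norm (f x) * K)\<^sup>2"
        by (intro power_mono K) simp
      then show "norm ((norm (L (f x)))\<^sup>2) \<le> norm ((norm (f x))\<^sup>2 * K\<^sup>2)"
        by (simp add: power_mult_distrib)
    qed
  qed measurable
qed

text \<open>The cross term \<open>u \<bullet> L \<eta>\<close> is a linear functional of centred
  noise and integrates to 0. The number \<open>c\<close> is a slot for whatever does not depend on
  the noise: the divergence term of the loss, or minus its absolute value when a dominating function
  is computed.\<close>

lemma integral_noise_marginal:
  fixes L :: "real^'m \<Rightarrow> real^'n" and c :: real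
  assumes "\<delta> > 0" "linear L"
  shows "integrable (gaussian_noise \<delta>) (\<lambda>\<eta>. 1/2 * (norm (u - L \<eta>))\<^sup>2 - c)"
    and "(\<integral>\<eta>. 1/2 * (norm (u - L \<eta>))\<^sup>2 - c \<partial>gaussian_noise \<delta>)
      = 1/2 * (norm u)\<^sup>2 + 1/2 * (\<integral>\<eta>. (norm (L \<eta>))\<^sup>2 \<partial>gaussian_noise \<delta>) - c"
proof -
  interpret N: prob_space "gaussian_noise \<delta> :: (real^'m) measure"
    by (rule prob_space_gaussian_noise[OF assms(1)])
  have "linear (\<lambda>\<eta>. u \<bullet> L \<eta>)"
    using assms(2) by (simp add: linear_iff inner_add_right)
  note i1 = gaussian_noise_linear_functional[OF assms(1) this]
  note i2 = gaussian_noise_linear_norm_sq[OF assms]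
  show "integrable (gaussian_noise \<delta>) (\<lambda>\<eta>. 1/2 * (norm (u - L \<eta>))\<^sup>2 - c)"
    unfolding norm_diff_sq using i1(1) i2 by simp
  have "(\<integral>\<eta>. 1/2 * (norm (u - L \<eta>))\<^sup>2 - c \<partial>gaussian_noise \<delta>)
      = (\<integral>\<eta>. (1/2 * (norm u)\<^sup>2 - c) - u \<bullet> L \<eta> + 1/2 * (norm (L \<eta>))\<^sup>2 \<partial>gaussian_noise \<delta>)"
    unfolding norm_diff_sq by (intro Bochner_Integration.integral_cong) (auto simp: field_simps)
  also have "\<dots> = (1/2 * (norm u)\<^sup>2 - c) - 0 + 1/2 * (\<integral>\<eta>. (norm (L \<eta>))\<^sup>2 \<partial>gaussian_noise \<delta>)"
    using i1 i2 N.prob_space by simp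
  finally show "(\<integral>\<eta>. 1/2 * (norm (u - L \<eta>))\<^sup>2 - c \<partial>gaussian_noise \<delta>)
      = 1/2 * (norm u)\<^sup>2 + 1/2 * (\<integral>\<eta>. (norm (L \<eta>))\<^sup>2 \<partial>gaussian_noise \<delta>) - c" by simp
qed

text \<open>By linearity of the adjoint the residual is \<open>u x - adjoint A \<eta>\<close> with
  \<open>u x = \<phi> x - adjoint A (A x)\<close>. Integrating over the noise inside, by Fubini,
  leaves half the second moment of \<open>adjoint A \<eta>\<close>, a number independent of
  \<open>\<phi>\<close>.\<close>

lemma div_reg_loss_eq_prior_integral:
  fixes A :: "real^'n \<Rightarrow> real^'m"
  assumes "linear A" "\<delta> > 0" "prob_space (prior p)"
    and \<phi>[measurable]: "\<phi> \<in> borel_measurable borel"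
    and div[measurable]: "divergence \<phi> \<in> borel_measurable borel"
    and int1: "integrable (prior p) (\<lambda>x. (norm (\<phi> x - adjoint A (A x)))\<^sup>2)"
    and int2: "integrable (prior p) (divergence \<phi>)"
  shows "div_reg_loss A \<delta> \<delta>' p \<phi> =
    (\<integral>x. 1/2 * (norm (\<phi> x - adjoint A (A x)))\<^sup>2 - \<delta>'\<^sup>2 * divergence \<phi> x \<partial>prior p)
    + 1/2 * (\<integral>\<eta>. (norm (adjoint A \<eta>))\<^sup>2 \<partial>gaussian_noise \<delta>)"
proof -
  interpret P: prob_space "prior p" by fact
  interpret N: prob_space "gaussian_noise \<delta> :: (real^'m) measure"
    by (rule prob_space_gaussian_noise[OF assms(2)])
  interpret PN: pair_sigma_finite "prior p" "gaussian_noise \<delta> :: (real^'m) measure" ..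
  have linA': "linear (adjoint A)" by (rule adjoint_linear[OF assms(1)])
  have [measurable]: "A \<in> borel_measurable borel" "adjoint A \<in> borel_measurable borel"
    using assms(1) linA' by (auto intro: linear_borel_measurable)
  define u where "u x = \<phi> x - adjoint A (A x)" for x
  have [measurable]: "u \<in> borel_measurable borel" unfolding u_def by measurable
  let ?E = "\<integral>\<eta>. (norm (adjoint A \<eta>))\<^sup>2 \<partial>gaussian_noise \<delta>"
  define H where "H x \<eta> = 1/2 * (norm (u x - adjoint A \<eta>))\<^sup>2 - \<delta>'\<^sup>2 * divergence \<phi> x" for x \<eta>
  have int1': "integrable (prior p) (\<lambda>x. (norm (u x))\<^sup>2)"
    using int1 by (simp add: u_def)
  have "div_reg_loss A \<delta> \<delta>' p \<phi> =
    (\<integral>w. (\<lambda>(x, z). 1/2 * (norm (\<phi> x - z))\<^sup>2 - \<delta>'\<^sup>2 * divergence \<phi> x) ((\<lambda>(x, \<eta>). (x, adjoint A (A x + \<eta>))) w)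
      \<partial>(prior p \<Otimes>\<^sub>M gaussian_noise \<delta>))"
    unfolding div_reg_loss_def joint_law_def by (rule integral_distr) measurable
  also have "\<dots> = (\<integral>w. (case w of (x, \<eta>) \<Rightarrow> H x \<eta>) \<partial>(prior p \<Otimes>\<^sub>M gaussian_noise \<delta>))"
    by (intro Bochner_Integration.integral_cong)
      (auto simp: H_def u_def linear_add[OF linA'] algebra_simps)
  also have "\<dots> = (\<integral>x. (\<integral>\<eta>. H x \<eta> \<partial>gaussian_noise \<delta>) \<partial>prior p)"
  proof (rule PN.integral_fst'[symmetric, where f="\<lambda>w. case w of (x, \<eta>) \<Rightarrow> H x \<eta>", simplified])
    show "integrable (prior p \<Otimes>\<^sub>M gaussian_noise \<delta>) (\<lambda>(x, \<eta>). H x \<eta>)"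
    proof (rule PN.Fubini_integrable)
      show meas[measurable]: "(\<lambda>(x, \<eta>). H x \<eta>) \<in> borel_measurable (prior p \<Otimes>\<^sub>M gaussian_noise \<delta>)"
        unfolding H_def by measurable
      have Hint: "integrable (gaussian_noise \<delta>) (\<lambda>\<eta>. H x \<eta>)" for x
        unfolding H_def by (rule integral_noise_marginal(1)[OF assms(2) linA'])
      then show "AE x in prior p. integrable (gaussian_noise \<delta>) (\<lambda>\<eta>. case (x, \<eta>) of (x, \<eta>) \<Rightarrow> H x \<eta>)"
        by simp
      have "integrable (prior p) (\<lambda>x. \<integral>\<eta>. norm (H x \<eta>) \<partial>gaussian_noise \<delta>)"
      proof (rule Bochner_Integration.integrable_bound)
        \<comment> \<open>The double minus keeps the shape of \<open>integral_noise_marginal\<close>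
          with \<open>c = - (\<delta>'\<^sup>2 * norm (divergence \<phi> x))\<close>, so that lemma
          evaluates the bound exactly.\<close>
        let ?w = "\<lambda>x. 1/2 * (norm (u x))\<^sup>2 + 1/2 * ?E - (- (\<delta>'\<^sup>2 * norm (divergence \<phi> x)))"
        show "integrable (prior p) ?w" using int1' int2 by simp
        show "AE x in prior p. norm (\<integral>\<eta>. norm (H x \<eta>) \<partial>gaussian_noise \<delta>) \<le> norm (?w x)"
        proof (rule AE_I2)
          fix x
          have "(\<integral>\<eta>. norm (H x \<eta>) \<partial>gaussian_noise \<delta>) \<le>
              (\<integral>\<eta>. 1/2 * (norm (u x - adjoint A \<eta>))\<^sup>2 - (- (\<delta>'\<^sup>2 * norm (divergence \<phi> x))) \<partial>gaussian_noise \<delta>)"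
          proof (rule integral_mono)
            show "integrable (gaussian_noise \<delta>) (\<lambda>\<eta>. norm (H x \<eta>))" by (rule integrable_norm[OF Hint])
            show "norm (H x \<eta>) \<le> 1/2 * (norm (u x - adjoint A \<eta>))\<^sup>2 - (- (\<delta>'\<^sup>2 * norm (divergence \<phi> x)))" for \<eta>
              unfolding H_def by (rule order_trans[OF norm_triangle_ineq4]) (simp add: abs_mult)
          qed (rule integral_noise_marginal(1)[OF assms(2) linA'])
          also have "\<dots> = ?w x"
            by (rule integral_noise_marginal(2)[OF assms(2) linA'])
          finally show "norm (\<integral>\<eta>. norm (H x \<eta>) \<partial>gaussian_noise \<delta>) \<le> norm (?w x)"
            by simp
        qed
      qed measurable
      then show "integrable (prior p) (\<lambda>x. \<integral>\<eta>. norm (case (x, \<eta>) of (x, \<eta>) \<Rightarrow> H x \<eta>) \<partial>gaussian_noise \<delta>)"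
        by simp
    qed
  qed
  also have "\<dots> = (\<integral>x. (1/2 * (norm (u x))\<^sup>2 - \<delta>'\<^sup>2 * divergence \<phi> x) + 1/2 * ?E \<partial>prior p)"
    unfolding H_def integral_noise_marginal(2)[OF assms(2) linA'] by (simp add: algebra_simps)
  also have "\<dots> = (\<integral>x. 1/2 * (norm (u x))\<^sup>2 - \<delta>'\<^sup>2 * divergence \<phi> x \<partial>prior p) + 1/2 * ?E"
    using int1' int2 P.prob_space by (subst Bochner_Integration.integral_add) simp_all
  finally show ?thesis by (simp add: u_def)
qed

text \<open>Stein's identity is integration by parts with weight \<open>p\<close>, rewritten by
  \<open>p \<nabla> ln p = \<nabla> p\<close>. Square integrability under the prior supplies all the
  Lebesgue integrability that is required beyond that of the divergence.\<close>

lemma integral_prior_divergence: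
  fixes p :: "real^'n \<Rightarrow> real" and \<phi> :: "real^'n \<Rightarrow> real^'n"
  assumes pos: "\<And>x. p x > 0" and p: "C1_map p" and "prob_space (prior p)"
    and \<phi>: "C1_map \<phi>" and int_\<phi>: "integrable (prior p) (\<lambda>x. (norm (\<phi> x))\<^sup>2)"
    and int_div: "integrable (prior p) (divergence \<phi>)"
    and int_score: "integrable (prior p) (\<lambda>x. (norm (gradient (\<lambda>y. ln (p y)) x))\<^sup>2)"
  shows "(\<integral>x. divergence \<phi> x \<partial>prior p) = - (\<integral>x. \<phi> x \<bullet> gradient (\<lambda>y. ln (p y)) x \<partial>prior p)"
proof -
  interpret P: prob_space "prior p" by fact
  let ?s = "gradient (\<lambda>y. ln (p y))"
  have [measurable]: "p \<in> borel_measurable borel" "\<phi> \<in> borel_measurable borel"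
    "divergence \<phi> \<in> borel_measurable borel" "?s \<in> borel_measurable borel"
    using C1_map_continuous[OF p] C1_map_continuous[OF \<phi>] continuous_on_divergence[OF \<phi>]
      continuous_on_gradient[OF C1_map_ln[OF p pos]]
    by (auto intro: borel_measurable_continuous_onI)
  have p0: "AE x in lborel. 0 \<le> p x" by (intro AE_I2 less_imp_le pos)
  have s: "p x * (\<phi> x \<bullet> ?s x) = \<phi> x \<bullet> gradient p x" for x
    using pos[of x] by (simp add: gradient_ln[OF p pos])
  have "integrable (prior p) (\<lambda>x. \<phi> x \<bullet> ?s x)"
    by (intro integrable_inner_sq int_\<phi> int_score) measurable
  then have i2: "integrable lborel (\<lambda>x. \<phi> x \<bullet> gradient p x)"
    unfolding prior_def by (subst (asm) integrable_density) (auto simp: p0 s)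
  have i1: "integrable lborel (\<lambda>x. p x * divergence \<phi> x)"
    using int_div unfolding prior_def by (subst (asm) integrable_density) (auto simp: p0)
  \<comment> \<open>On a probability space square integrability implies integrability. This is the
    hypothesis that controls the cut-off error.\<close>
  have "integrable (prior p) \<phi>"
  proof (rule Bochner_Integration.integrable_bound)
    show "integrable (prior p) (\<lambda>x. 1 + (norm (\<phi> x))\<^sup>2)" using int_\<phi> by simp
    show "AE x in prior p. norm (\<phi> x) \<le> norm (1 + (norm (\<phi> x))\<^sup>2)"
    proof (rule AE_I2)
      fix x
      have "2 * norm (\<phi> x) \<le> 1 + (norm (\<phi> x))\<^sup>2"
        using sum_squares_bound[of 1 "norm (\<phi> x)"] by simp
      then show "norm (\<phi> x) \<le> norm (1 + (norm (\<phi> x))\<^sup>2)"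
        by (smt (verit) norm_ge_zero real_norm_def)
    qed
  qed measurable
  then have i3: "integrable lborel (\<lambda>x. p x *\<^sub>R \<phi> x)"
    unfolding prior_def by (subst (asm) integrable_density) (auto simp: p0)
  have "(\<integral>x. divergence \<phi> x \<partial>prior p) = (\<integral>x. p x * divergence \<phi> x \<partial>lborel)"
    unfolding prior_def by (subst integral_density) (auto simp: p0)
  also have "\<dots> = - (\<integral>x. \<phi> x \<bullet> gradient p x \<partial>lborel)"
    by (rule integral_by_parts_divergence[OF p \<phi> i1 i2 i3])
  also have "(\<integral>x. \<phi> x \<bullet> gradient p x \<partial>lborel) = (\<integral>x. \<phi> x \<bullet> ?s x \<partial>prior p)"
    unfolding prior_def by (subst integral_density) (auto simp: p0 s)
  finally show ?thesis .
qed

section \<open>The loss as a squared distance to the target\<close>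

definition target :: "(real^'n \<Rightarrow> real^'m) \<Rightarrow> real \<Rightarrow> (real^'n \<Rightarrow> real) \<Rightarrow> real^'n \<Rightarrow> real^'n" where
  "target A \<delta>' p x = adjoint A (A x) - \<delta>'\<^sup>2 *\<^sub>R gradient (\<lambda>y. ln (p y)) x"

text \<open>Integrability of the absolute value passes to the divergence itself once the latter is
  measurable, and measurability comes from its continuity for a C^1 map.\<close>

lemma modelsD:
  assumes "\<phi> \<in> models p"
  shows "\<phi> \<in> Diff2" "C1_map \<phi>" "integrable (prior p) (\<lambda>x. (norm (\<phi> x))\<^sup>2)"
    "integrable (prior p) (divergence \<phi>)"
proof -
  show *: "\<phi> \<in> Diff2" "integrable (prior p) (\<lambda>x. (norm (\<phi> x))\<^sup>2)"
    using assms by (auto simp: models_def)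
  then show C1: "C1_map \<phi>"
    by (auto simp: Diff2_def intro: C2_map_imp_C1_map)
  have "divergence \<phi> \<in> borel_measurable (prior p)"
    using borel_measurable_continuous_onI[OF continuous_on_divergence[OF C1]] by simp
  then show "integrable (prior p) (divergence \<phi>)"
    using assms by (simp add: models_def integrable_abs_iff)
qed

lemma modelsI:
  assumes "\<phi> \<in> Diff2" "integrable (prior p) (\<lambda>x. (norm (\<phi> x))\<^sup>2)" "integrable (prior p) (divergence \<phi>)"
  shows "\<phi> \<in> models p"
  using assms by (auto simp: models_def)

lemma div_reg_loss_eq_target_loss:
  fixes A :: "real^'n \<Rightarrow> real^'m" and p :: "real^'n \<Rightarrow> real"
  assumes "linear A" "\<delta> > 0" and pos: "\<And>x. p x > 0" and p: "C1_map p" and prob: "prob_space (prior p)"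
    and int_x: "integrable (prior p) (\<lambda>x. (norm x)\<^sup>2)"
    and int_score: "integrable (prior p) (\<lambda>x. (norm (gradient (\<lambda>y. ln (p y)) x))\<^sup>2)"
  shows "\<exists>c. \<forall>\<phi>\<in>models p. div_reg_loss A \<delta> \<delta>' p \<phi> =
    (\<integral>x. 1/2 * (norm (\<phi> x - target A \<delta>' p x))\<^sup>2 \<partial>prior p) + c"
proof -
  interpret P: prob_space "prior p" by fact
  let ?s = "gradient (\<lambda>y. ln (p y))" and ?a = "\<lambda>x. adjoint A (A x)"
  let ?E = "\<integral>\<eta>. (norm (adjoint A \<eta>))\<^sup>2 \<partial>gaussian_noise \<delta>"
  \<comment> \<open>The first summand is the noise energy. The other two cancel the terms free of
    \<open>\<phi>\<close> that appear when the squared distance to the target is expanded: the mixed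
    term of \<open>?a\<close> with the score \<open>?s\<close>, and the square of the score.\<close>
  let ?C = "1/2 * ?E + \<delta>'\<^sup>2 * (\<integral>x. ?a x \<bullet> ?s x \<partial>prior p) - 1/2 * \<delta>'^4 * (\<integral>x. (norm (?s x))\<^sup>2 \<partial>prior p)"
  have linA: "linear ?a"
    using linear_compose[OF assms(1) adjoint_linear[OF assms(1)]] by (simp add: o_def)
  have [measurable]: "?a \<in> borel_measurable borel" "?s \<in> borel_measurable borel"
    using linear_borel_measurable[OF linA] continuous_on_gradient[OF C1_map_ln[OF p pos]]
    by (auto intro: borel_measurable_continuous_onI)
  have int_a: "integrable (prior p) (\<lambda>x. (norm (?a x))\<^sup>2)"
    by (rule integrable_linear_sq[OF linA _ int_x]) measurable
  have int_as: "integrable (prior p) (\<lambda>x. ?a x \<bullet> ?s x)"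
    by (intro integrable_inner_sq int_a int_score) measurable
  show ?thesis
  proof (intro exI[of _ ?C] ballI)
    fix \<phi> assume m: "\<phi> \<in> models p"
    note md = modelsD[OF m]
    have [measurable]: "\<phi> \<in> borel_measurable borel" "divergence \<phi> \<in> borel_measurable borel"
      using C1_map_continuous[OF md(2)] continuous_on_divergence[OF md(2)]
      by (auto intro: borel_measurable_continuous_onI)
    have int_d: "integrable (prior p) (\<lambda>x. (norm (\<phi> x - ?a x))\<^sup>2)"
      by (intro integrable_diff_sq md int_a) measurable
    have int_ps: "integrable (prior p) (\<lambda>x. \<phi> x \<bullet> ?s x)"
      by (intro integrable_inner_sq md int_score) measurable
    have expand: "(norm (\<phi> x - target A \<delta>' p x))\<^sup>2 = (norm (\<phi> x - ?a x))\<^sup>2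
        + 2 * \<delta>'\<^sup>2 * (\<phi> x \<bullet> ?s x) - 2 * \<delta>'\<^sup>2 * (?a x \<bullet> ?s x) + \<delta>'^4 * (norm (?s x))\<^sup>2" for x
    proof -
      have "\<phi> x - target A \<delta>' p x = (\<phi> x - ?a x) - (- (\<delta>'\<^sup>2 *\<^sub>R ?s x))" by (simp add: target_def)
      then show ?thesis
        by (simp only: norm_diff_sq[of "\<phi> x - ?a x"])
          (simp add: inner_diff_left power_mult_distrib algebra_simps flip: power_mult)
    qed
    have "(\<integral>x. 1/2 * (norm (\<phi> x - target A \<delta>' p x))\<^sup>2 \<partial>prior p)
      = (\<integral>x. 1/2 * (norm (\<phi> x - ?a x))\<^sup>2 + \<delta>'\<^sup>2 * (\<phi> x \<bullet> ?s x) - \<delta>'\<^sup>2 * (?a x \<bullet> ?s x) + 1/2 * \<delta>'^4 * (norm (?s x))\<^sup>2 \<partial>prior p)"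
      unfolding expand by (intro Bochner_Integration.integral_cong) (auto simp: algebra_simps)
    also have "\<dots> = 1/2 * (\<integral>x. (norm (\<phi> x - ?a x))\<^sup>2 \<partial>prior p) + \<delta>'\<^sup>2 * (\<integral>x. \<phi> x \<bullet> ?s x \<partial>prior p)
        - \<delta>'\<^sup>2 * (\<integral>x. ?a x \<bullet> ?s x \<partial>prior p) + 1/2 * \<delta>'^4 * (\<integral>x. (norm (?s x))\<^sup>2 \<partial>prior p)"
      using int_d int_ps int_as int_score by simp
    also have "\<delta>'\<^sup>2 * (\<integral>x. \<phi> x \<bullet> ?s x \<partial>prior p) = - (\<delta>'\<^sup>2 * (\<integral>x. divergence \<phi> x \<partial>prior p))"
      using integral_prior_divergence[OF pos p prob md(2,3,4) int_score] by simp
    finally have K: "(\<integral>x. 1/2 * (norm (\<phi> x - target A \<delta>' p x))\<^sup>2 \<partial>prior p)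
      = 1/2 * (\<integral>x. (norm (\<phi> x - ?a x))\<^sup>2 \<partial>prior p) + - (\<delta>'\<^sup>2 * (\<integral>x. divergence \<phi> x \<partial>prior p))
        - \<delta>'\<^sup>2 * (\<integral>x. ?a x \<bullet> ?s x \<partial>prior p) + 1/2 * \<delta>'^4 * (\<integral>x. (norm (?s x))\<^sup>2 \<partial>prior p)" .
    have J: "(\<integral>x. 1/2 * (norm (\<phi> x - target A \<delta>' p x))\<^sup>2 \<partial>prior p) + ?C
      = 1/2 * (\<integral>x. (norm (\<phi> x - ?a x))\<^sup>2 \<partial>prior p) - \<delta>'\<^sup>2 * (\<integral>x. divergence \<phi> x \<partial>prior p) + 1/2 * ?E"
      unfolding K by linarith
    have "div_reg_loss A \<delta> \<delta>' p \<phi> =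
      (\<integral>x. 1/2 * (norm (\<phi> x - ?a x))\<^sup>2 - \<delta>'\<^sup>2 * divergence \<phi> x \<partial>prior p) + 1/2 * ?E"
      by (intro div_reg_loss_eq_prior_integral assms(1,2) prob int_d md(4)) measurable
    then show "div_reg_loss A \<delta> \<delta>' p \<phi> = (\<integral>x. 1/2 * (norm (\<phi> x - target A \<delta>' p x))\<^sup>2 \<partial>prior p) + ?C"
      unfolding J using int_d md(4) by simp
  qed
qed

section \<open>Minimizers\<close>

text \<open>If the integral vanished, \<open>f\<close> would be 0 almost everywhere, also for
  Lebesgue measure because \<open>p\<close> is positive. By continuity \<open>f x0 > 0\<close> holds
  on a nonempty open set, which is not negligible.\<close>

lemma integral_prior_pos:
  fixes f :: "'a::euclidean_space \<Rightarrow> real"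
  assumes pos: "\<And>x. p x > 0" and [measurable]: "p \<in> borel_measurable borel"
    and f: "continuous_on UNIV f" "\<And>x. f x \<ge> 0" "f x0 > 0" "integrable (prior p) f"
  shows "(\<integral>x. f x \<partial>prior p) > 0"
proof (rule ccontr)
  assume "\<not> ?thesis"
  then have "(\<integral>x. f x \<partial>prior p) = 0"
    using Bochner_Integration.integral_nonneg[of "prior p" f] f(2) by (simp add: not_less antisym)
  then have "AE x in prior p. f x = 0"
    using integral_nonneg_eq_0_iff_AE[OF f(4)] f(2) by simp
  then have "AE x in density lborel (\<lambda>x. ennreal (p x)). f x = 0"
    unfolding prior_def .
  then have "AE x in lborel. f x = 0"
    using pos by (subst (asm) AE_density) auto
  moreover have op: "open {x. f x \<noteq> 0}"
    using f(1) by (intro open_Collect_neq continuous_on_const)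
  ultimately have "{x. f x \<noteq> 0} \<in> null_sets lborel"
    by (subst AE_iff_null_sets) auto
  then have "negligible {x. f x \<noteq> 0}"
    by (simp add: negligible_iff_null_sets null_sets_completionI)
  moreover have "x0 \<in> {x. f x \<noteq> 0}" using f(3) by simp
  ultimately show False using op open_not_negligible by blast
qed

text \<open>Membership needs integrability besides \<open>Diff2\<close>. The values move by at most
  \<open>norm e\<close>, and the divergence changes only where \<open>\<phi> x\<close> lies in the
  ball around \<open>y\<close>, by an amount that is bounded there.\<close>

lemma models_perturbation:
  fixes p :: "real^'n \<Rightarrow> real" and e :: "real^'n"
  assumes prob: "prob_space (prior p)" and m: "\<phi> \<in> models p" and r: "r > 0" and small: "6 / r * norm e \<le> 1/2"
  shows "(\<lambda>x. \<phi> x + bump y r (\<phi> x) *\<^sub>R e) \<in> models p"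
proof -
  interpret P: prob_space "prior p" by fact
  note md = modelsD[OF m]
  let ?\<psi> = "\<lambda>x. \<phi> x + bump y r (\<phi> x) *\<^sub>R e"
  obtain \<phi>' where \<phi>': "\<And>x. (\<phi> has_derivative blinfun_apply (\<phi>' x)) (at x)" "continuous_on UNIV \<phi>'"
    using md(2) unfolding C1_map_def by blast
  note cont = C1_map_continuous[OF md(2)]
  have "(\<lambda>z. z + bump y r z *\<^sub>R e) \<in> Diff2"
    by (rule rank_one_perturbation_Diff2[OF bump_has_derivative C1_map_bump' norm_bump'_le[OF r] small])
  then have D: "?\<psi> \<in> Diff2"
    by (rule Diff2_compose[OF _ md(1)])
  then have C1: "C1_map ?\<psi>"
    by (auto simp: Diff2_def intro: C2_map_imp_C1_map)
  have [measurable]: "\<phi> \<in> borel_measurable borel" "?\<psi> \<in> borel_measurable borel"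
    using cont C1_map_continuous[OF C1] by (auto intro: borel_measurable_continuous_onI)
  have "integrable (prior p) (\<lambda>x. (norm (?\<psi> x))\<^sup>2)"
  proof (rule Bochner_Integration.integrable_bound)
    show "integrable (prior p) (\<lambda>x. 2 * (norm (\<phi> x))\<^sup>2 + 2 * (norm e)\<^sup>2)"
      using md(3) by simp
    show "AE x in prior p. norm ((norm (?\<psi> x))\<^sup>2) \<le> norm (2 * (norm (\<phi> x))\<^sup>2 + 2 * (norm e)\<^sup>2)"
    proof (rule AE_I2)
      fix x
      have "norm (bump y r (\<phi> x) *\<^sub>R e) \<le> 1 * norm e"
        unfolding norm_scaleR using bump_bounds[of y r "\<phi> x"] by (intro mult_right_mono) auto
      then have "norm (?\<psi> x) \<le> norm (\<phi> x) + norm e"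
        using norm_triangle_ineq[of "\<phi> x" "bump y r (\<phi> x) *\<^sub>R e"] by simp
      then have "(norm (?\<psi> x))\<^sup>2 \<le> (norm (\<phi> x) + norm e)\<^sup>2"
        by (intro power_mono) simp_all
      also have "\<dots> \<le> 2 * (norm (\<phi> x))\<^sup>2 + 2 * (norm e)\<^sup>2"
        using sum_squares_bound[of "norm (\<phi> x)" "norm e"] by (simp add: power2_sum)
      finally show "norm ((norm (?\<psi> x))\<^sup>2) \<le> norm (2 * (norm (\<phi> x))\<^sup>2 + 2 * (norm e)\<^sup>2)" by simp
    qed
  qed measurable
  moreover have "integrable (prior p) (divergence ?\<psi>)"
  proof -
    \<comment> \<open>The derivative gains the rank-one map sending \<open>h\<close> to
      \<open>bump' y r (\<phi> x) (\<phi>' x h) *\<^sub>R e\<close>. Its trace is the functional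
      part evaluated at \<open>e\<close>.\<close>
    let ?d = "\<lambda>x. bump' y r (\<phi> x) (\<phi>' x e)"
    have div: "divergence ?\<psi> x = divergence \<phi> x + ?d x" for x
    proof -
      have "(?\<psi> has_derivative (\<lambda>h. \<phi>' x h + bump' y r (\<phi> x) (\<phi>' x h) *\<^sub>R e)) (at x)"
        by (intro has_derivative_add \<phi>'(1) has_derivative_scaleR_left
            has_derivative_compose[OF \<phi>'(1) bump_has_derivative])
      from divergence_eq[OF this]
      have "divergence ?\<psi> x = (\<Sum>i\<in>UNIV. \<phi>' x (axis i 1) $ i)
          + (\<Sum>i\<in>UNIV. (e $ i) *\<^sub>R (bump' y r (\<phi> x) o\<^sub>L \<phi>' x) (axis i 1))"
        by (simp add: sum.distrib mult.commute)
      also have "(\<Sum>i\<in>UNIV. (e $ i) *\<^sub>R (bump' y r (\<phi> x) o\<^sub>L \<phi>' x) (axis i 1)) = (bump' y r (\<phi> x) o\<^sub>L \<phi>' x) e"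
        by (rule linear_sum_axis[symmetric]) (rule bounded_linear.linear[OF blinfun.bounded_linear_right])
      finally show ?thesis by (simp add: divergence_eq[OF \<phi>'(1)])
    qed
    have inv_cont: "continuous_on UNIV (inv \<phi>)" and bij: "bij \<phi>"
      using md(1) by (auto simp: Diff2_def intro: C1_map_continuous C2_map_imp_C1_map)
    \<comment> \<open>\<open>\<phi>'\<close> may be unbounded on the whole space, but the ball pulls
      back to a compact set because \<open>inv \<phi>\<close> is continuous, and outside that set
      \<open>?d\<close> is 0.\<close>
    let ?K = "inv \<phi> ` cball y r"
    have dcont: "continuous_on UNIV ?d"
      by (intro continuous_intros continuous_on_compose2[OF C1_map_continuous[OF C1_map_bump'] cont] \<phi>'(2)) auto
    have "compact (?d ` ?K)"
      by (intro compact_continuous_image continuous_on_subset[OF dcont] continuous_on_subset[OF inv_cont]) auto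
    then obtain B where B: "\<forall>x\<in>?K. norm (?d x) \<le> B"
      by (auto dest!: compact_imp_bounded simp: bounded_iff)
    have "norm (?d x) \<le> max B 0" for x
    proof (cases "x \<in> ?K")
      case False
      have "\<phi> x \<notin> cball y r"
        using False bij by (metis bij_inv_eq_iff imageI)
      then have "r \<le> norm (\<phi> x - y)" by (simp add: dist_norm norm_minus_commute)
      then show ?thesis using r by (simp add: bump'_eq_0)
    qed (use B in auto)
    then have "integrable (prior p) ?d"
      by (intro P.integrable_const_bound[of _ "max B 0"])
        (use borel_measurable_continuous_onI[OF dcont] in auto)
    then show ?thesis
      unfolding div using md(4) by (intro Bochner_Integration.integrable_add)
  qed
  ultimately show ?thesis by (intro modelsI D)
qed

text \<open>Along the family moved by \<open>t *\<^sub>R e\<close> the loss is the quadratic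
  \<open>J - t * I + 1/2 * t\<^sup>2 * Q\<close> in \<open>t\<close>. Its slope at 0 is negative
  once the bump is supported where moving along \<open>e\<close> points towards
  \<open>g\<close>.\<close>

lemma models_improvement:
  fixes p :: "real^'n \<Rightarrow> real" and g :: "real^'n \<Rightarrow> real^'n"
  assumes pos: "\<And>x. p x > 0" and [measurable]: "p \<in> borel_measurable borel"
    and prob: "prob_space (prior p)" and m: "\<phi> \<in> models p"
    and g: "continuous_on UNIV g" "integrable (prior p) (\<lambda>x. (norm (g x))\<^sup>2)"
    and x0: "\<phi> x0 \<noteq> g x0"
  shows "\<exists>\<psi>\<in>models p. (\<integral>x. 1/2 * (norm (\<psi> x - g x))\<^sup>2 \<partial>prior p) < (\<integral>x. 1/2 * (norm (\<phi> x - g x))\<^sup>2 \<partial>prior p)"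
proof -
  interpret P: prob_space "prior p" by fact
  note md = modelsD[OF m]
  note cont = C1_map_continuous[OF md(2)]
  define e where "e = g x0 - \<phi> x0"
  have e0: "norm e > 0" using x0 by (simp add: e_def)
  define d where "d x = (g x - \<phi> x) \<bullet> e" for x
  have d0: "d x0 > 0" using x0 by (simp add: d_def e_def)
  have dcont: "continuous_on UNIV d" unfolding d_def by (intro continuous_intros g cont)
  have inv_cont: "continuous_on UNIV (inv \<phi>)" and bij: "bij \<phi>"
    using md(1) by (auto simp: Diff2_def intro: C1_map_continuous C2_map_imp_C1_map)
  have inv: "inv \<phi> (\<phi> x) = x" for x using bij by (simp add: bij_is_inj)
  \<comment> \<open>The radius is chosen in the target space because the bump is evaluated at
    \<open>\<phi> x\<close>. Where the bump is positive, \<open>d\<close> is positive as well, so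
    \<open>w x * d x\<close> never becomes negative.\<close>
  have "open {y. 0 < d (inv \<phi> y)}"
    by (intro open_Collect_less continuous_on_const continuous_on_compose2[OF dcont inv_cont]) auto
  then obtain r where r: "r > 0" "ball (\<phi> x0) r \<subseteq> {y. 0 < d (inv \<phi> y)}"
    using d0 inv by (metis (no_types, lifting) mem_Collect_eq open_contains_ball)
  define w where "w x = bump (\<phi> x0) r (\<phi> x)" for x
  have w: "0 \<le> w x" "w x \<le> 1" for x unfolding w_def by (rule bump_bounds)+
  have wcont: "continuous_on UNIV w"
    unfolding w_def bump_def by (intro continuous_intros cont) (use r in auto)
  have wd: "0 \<le> w x * d x" for x
  proof (cases "\<phi> x \<in> ball (\<phi> x0) r")
    case True
    then have "0 < d x" using r(2) inv by fastforce
    then show ?thesis using w by simp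
  next
    case False
    then show ?thesis
      using r(1) by (simp add: w_def bump_eq_0 dist_norm norm_minus_commute)
  qed
  have [measurable]: "\<phi> \<in> borel_measurable borel" "g \<in> borel_measurable borel" "w \<in> borel_measurable borel"
    using cont g(1) wcont by (auto intro: borel_measurable_continuous_onI)
  have int_we: "integrable (prior p) (\<lambda>x. (norm (w x *\<^sub>R e))\<^sup>2)"
  proof (rule P.integrable_const_bound[of _ "(norm e)\<^sup>2"])
    show "AE x in prior p. norm ((norm (w x *\<^sub>R e))\<^sup>2) \<le> (norm e)\<^sup>2"
      by (rule AE_I2) (use w in \<open>auto intro!: power_mono mult_left_le_one_le\<close>)
  qed measurable
  have int_d: "integrable (prior p) (\<lambda>x. (norm (\<phi> x - g x))\<^sup>2)"
    by (intro integrable_diff_sq md g) measurable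
  have int_d': "integrable (prior p) (\<lambda>x. (norm (g x - \<phi> x))\<^sup>2)"
    using int_d by (simp add: norm_minus_commute)
  have "integrable (prior p) (\<lambda>x. (g x - \<phi> x) \<bullet> (w x *\<^sub>R e))"
    by (intro integrable_inner_sq int_d' int_we) measurable
  then have int_wd: "integrable (prior p) (\<lambda>x. w x * d x)" by (simp add: d_def)
  define I where "I = (\<integral>x. w x * d x \<partial>prior p)"
  define Q where "Q = (\<integral>x. (norm (w x *\<^sub>R e))\<^sup>2 \<partial>prior p)"
  have I: "I > 0"
    unfolding I_def
    by (rule integral_prior_pos[OF pos, where ?x0.0 = x0])
      (use wd int_wd d0 in \<open>auto simp: w_def bump_center intro!: continuous_intros wcont[unfolded w_def] dcont\<close>)
  have Q: "Q \<ge> 0" unfolding Q_def by (intro Bochner_Integration.integral_nonneg) simp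
  \<comment> \<open>The first bound is exactly
    \<open>6 / r * norm (t *\<^sub>R e) \<le> 1/2\<close>, the invertibility condition. The second
    makes the quadratic term smaller than the linear gain; \<open>Q + 1\<close> avoids a division by
    0.\<close>
  define t where "t = min (r / (12 * norm e)) (I / (Q + 1))"
  have t: "t > 0" "t \<le> r / (12 * norm e)" "t \<le> I / (Q + 1)"
    using r(1) e0 I Q by (auto simp: t_def)
  let ?\<psi> = "\<lambda>x. \<phi> x + bump (\<phi> x0) r (\<phi> x) *\<^sub>R (t *\<^sub>R e)"
  have "?\<psi> \<in> models p"
  proof (rule models_perturbation[OF prob m r(1)])
    show "6 / r * norm (t *\<^sub>R e) \<le> 1 / 2"
      using t(1,2) r(1) e0 by (simp add: field_simps)
  qed
  moreover have "(\<integral>x. 1/2 * (norm (?\<psi> x - g x))\<^sup>2 \<partial>prior p) < (\<integral>x. 1/2 * (norm (\<phi> x - g x))\<^sup>2 \<partial>prior p)"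
  proof -
    have expand: "(norm (?\<psi> x - g x))\<^sup>2 = (norm (\<phi> x - g x))\<^sup>2 - 2 * t * (w x * d x) + t\<^sup>2 * (norm (w x *\<^sub>R e))\<^sup>2" for x
    proof -
      have "?\<psi> x - g x = (\<phi> x - g x) - (- t) *\<^sub>R (w x *\<^sub>R e)" by (simp add: w_def)
      then show ?thesis
        by (simp only: norm_diff_sq[of "\<phi> x - g x"])
          (simp add: d_def inner_diff_left power_mult_distrib algebra_simps)
    qed
    have "(\<integral>x. 1/2 * (norm (?\<psi> x - g x))\<^sup>2 \<partial>prior p)
      = (\<integral>x. 1/2 * (norm (\<phi> x - g x))\<^sup>2 - t * (w x * d x) + 1/2 * t\<^sup>2 * (norm (w x *\<^sub>R e))\<^sup>2 \<partial>prior p)"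
      unfolding expand by (intro Bochner_Integration.integral_cong) (auto simp: algebra_simps)
    also have "\<dots> = (\<integral>x. 1/2 * (norm (\<phi> x - g x))\<^sup>2 \<partial>prior p) - t * I + 1/2 * t\<^sup>2 * Q"
      unfolding I_def Q_def using int_d int_wd int_we by simp
    finally have eq: "(\<integral>x. 1/2 * (norm (?\<psi> x - g x))\<^sup>2 \<partial>prior p)
      = (\<integral>x. 1/2 * (norm (\<phi> x - g x))\<^sup>2 \<partial>prior p) - t * I + 1/2 * t\<^sup>2 * Q" .
    have "t * Q \<le> t * (Q + 1)" using t(1) by simp
    also have "\<dots> \<le> I" using t(3) Q by (simp add: field_simps)
    finally have "t * (t * Q) \<le> t * I" using t(1) by (intro mult_left_mono) auto
    moreover have "t * I > 0" using t(1) I by simp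
    ultimately have "1/2 * t\<^sup>2 * Q < t * I" by (simp add: power2_eq_square)
    then show ?thesis unfolding eq by simp
  qed
  ultimately show ?thesis by - (rule bexI[where x = ?\<psi>], assumption+)
qed

theorem theorem2:
  fixes A :: "real^'n \<Rightarrow> real^'m"
    and \<delta> \<delta>' :: real
    and p :: "real^'n \<Rightarrow> real"
  assumes "linear A"
    and "\<delta> > 0" and "\<delta>' > 0"
    and "\<And>x. p x > 0"
    and "C1_map p"
    and "prob_space (prior p)"
    and "integrable (prior p) (\<lambda>x. (norm x)\<^sup>2)"
    and "integrable (prior p) (\<lambda>x. (norm (gradient (\<lambda>y. ln (p y)) x))\<^sup>2)"
  shows "(\<exists>c. \<forall>\<phi> \<in> models p.
            div_reg_loss A \<delta> \<delta>' p \<phi> =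
            (\<integral>x. 1/2 * (norm (\<phi> x - (adjoint A (A x) - \<delta>'\<^sup>2 *\<^sub>R gradient (\<lambda>y. ln (p y)) x)))\<^sup>2
               \<partial>prior p) + c)
       \<and> (\<forall>\<phi>. is_arg_min (div_reg_loss A \<delta> \<delta>' p) (\<lambda>\<psi>. \<psi> \<in> models p) \<phi> \<longleftrightarrow>
            \<phi> \<in> models p \<and>
            \<phi> = (\<lambda>x. adjoint A (A x) - \<delta>'\<^sup>2 *\<^sub>R gradient (\<lambda>y. ln (p y)) x))"
proof -
  let ?g = "target A \<delta>' p"
  let ?J = "\<lambda>\<phi>. \<integral>x. 1/2 * (norm (\<phi> x - ?g x))\<^sup>2 \<partial>prior p"
  obtain c where c: "\<And>\<phi>. \<phi> \<in> models p \<Longrightarrow> div_reg_loss A \<delta> \<delta>' p \<phi> = ?J \<phi> + c"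
    using div_reg_loss_eq_target_loss[OF assms(1,2,4,5,6,7,8), of \<delta>'] by blast
  have linA: "linear (\<lambda>x. adjoint A (A x))"
    using linear_compose[OF assms(1) adjoint_linear[OF assms(1)]] by (simp add: o_def)
  have scont: "continuous_on UNIV (gradient (\<lambda>y. ln (p y)))"
    by (rule continuous_on_gradient[OF C1_map_ln[OF assms(5,4)]])
  have gcont: "continuous_on UNIV ?g"
    unfolding target_def using linA
    by (intro continuous_intros scont linear_continuous_on) (simp add: linear_conv_bounded_linear)
  have [measurable]: "(\<lambda>x. adjoint A (A x)) \<in> borel_measurable borel"
    "gradient (\<lambda>y. ln (p y)) \<in> borel_measurable borel"
    using linear_borel_measurable[OF linA] scont by (auto intro: borel_measurable_continuous_onI)
  have gint: "integrable (prior p) (\<lambda>x. (norm (?g x))\<^sup>2)"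
    unfolding target_def
  proof (intro integrable_diff_sq integrable_linear_sq[OF linA _ assms(7)])
    show "integrable (prior p) (\<lambda>x. (norm (\<delta>'\<^sup>2 *\<^sub>R gradient (\<lambda>y. ln (p y)) x))\<^sup>2)"
      using assms(8) by (simp add: power_mult_distrib)
  qed measurable
  have pm: "p \<in> borel_measurable borel"
    by (rule borel_measurable_continuous_onI[OF C1_map_continuous[OF assms(5)]])
  have "is_arg_min (div_reg_loss A \<delta> \<delta>' p) (\<lambda>\<psi>. \<psi> \<in> models p) \<phi> \<longleftrightarrow> \<phi> \<in> models p \<and> \<phi> = ?g" for \<phi>
  proof (intro iffI conjI)
    assume min: "is_arg_min (div_reg_loss A \<delta> \<delta>' p) (\<lambda>\<psi>. \<psi> \<in> models p) \<phi>"
    then show m: "\<phi> \<in> models p" by (simp add: is_arg_min_def)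
    show "\<phi> = ?g"
    proof (rule ccontr)
      assume "\<phi> \<noteq> ?g"
      \<comment> \<open>A single point of disagreement suffices, since the improvement is built
        locally around it.\<close>
      then obtain x0 where "\<phi> x0 \<noteq> ?g x0" by blast
      from models_improvement[OF assms(4) pm assms(6) m gcont gint this]
      obtain \<psi> where "\<psi> \<in> models p" "?J \<psi> < ?J \<phi>" by blast
      then show False using min m c by (force simp: is_arg_min_def)
    qed
  next
    assume *: "\<phi> \<in> models p \<and> \<phi> = ?g"
    \<comment> \<open>Conversely, a target that is itself a model attains the lower bound 0 of the
      squared distance, and the constant \<open>c\<close> cancels from the comparison.\<close>
    have "?J \<psi> \<ge> 0" for \<psi> by (intro Bochner_Integration.integral_nonneg) simp
    moreover have "?J \<phi> = 0" using * by simp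
    ultimately have "\<not> div_reg_loss A \<delta> \<delta>' p \<psi> < div_reg_loss A \<delta> \<delta>' p \<phi>" if "\<psi> \<in> models p" for \<psi>
      using c[OF that] c[of \<phi>] conjunct1[OF *] by (simp only: not_less) simp
    then show "is_arg_min (div_reg_loss A \<delta> \<delta>' p) (\<lambda>\<psi>. \<psi> \<in> models p) \<phi>"
      using * by (auto simp: is_arg_min_def)
  qed
  moreover have "?g = (\<lambda>x. adjoint A (A x) - \<delta>'\<^sup>2 *\<^sub>R gradient (\<lambda>y. ln (p y)) x)"
    by (simp add: target_def fun_eq_iff)
  ultimately show ?thesis using c unfolding target_def by auto
qed

end
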